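(* Let $K\subset\mathbb R^D$ be a star-regular polytope centered on the origin and let the representation space $\mathcal V$ be the space of polynomials in $D$ variables of degree at most $2$. Assume that the origin is the only point whose orbit under the isometries of $K$ is a singleton. Then the optimal interior weight is $\overline M^\star=\frac{D+2}{D}$, and enforcing positivity at the cell center is equivalent to enforcing positivity of the retentional $\overline{\mathcal R}^\star=\overline M^\star\,\overline{\mathcal C}-\overline{\mathcal B}$: for $U\in\mathcal V$, $U(0)\ge 0$ if and only if $\overline{\mathcal R}^\star(U)\ge 0$. The optimal time step is thus guaranteed simply by enforcing positivity at the boundary nodes and at the cell center: if $U\in\mathcal V$ is nonnegative at the boundary nodes and at the origin, $\overline h\le\overline\lambda\,U$ at each boundary node, and $\Delta t\ge 0$ satisfies $\overline\lambda\,\Delta t\le 1/\overline M^\star$, then $\overline{\mathcal C}U-\Delta t\,\overline{\mathcal B}\,\overline h\ge 0$.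
   Context: A star-regular polytope is a star-convex polytope that can be centered on the origin so that $\hat{\mathbf n}\cdot\mathbf x$ is constant on its boundary ($\hat{\mathbf n}$ the outward unit normal); the cell center is the origin. The isometries of $K$ are the isometries of $\mathbb R^D$ mapping $K$ onto itself. $\overline{\mathcal C}(U)$ is the average of $U$ over $K$; $\overline{\mathcal B}(U)$ is the average of $U$ over $\partial K$, computed by a quadrature $\overline{\mathcal B}g=\sum_{\mathbf x\in Q}b_{\mathbf x}g(\mathbf x)$ with finitely many boundary nodes $Q\subset\partial K$ and weights $b_{\mathbf x}>0$, exact for $U\in\mathcal V$. $\overline M^\star:=\sup\{\overline{\mathcal B}(U)/\overline{\mathcal C}(U): U\in\mathcal V,\ U\ge0\text{ in }K,\ \overline{\mathcal C}(U)>0\}$. The scaled numerical flux $\overline h$ is a real-valued function on the boundary nodes (outward flux times boundary area over cell volume), $\overline\lambda$ is a real number (scaled speed cap), and an Euler step replaces $\overline{\mathcal C}U$ by $\overline{\mathcal C}U-\Delta t\,\overline{\mathcal B}\,\overline h$. *)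

theory Defs
  imports "HOL-Analysis.Analysis"
begin

section \<open>Star-regular polytopes\<close>

text \<open>Polytopes need not be convex (a pentagram-shaped region is star-regular), so a polytope is a
  finite union of convex polytopes. All of them are full-dimensional, which excludes
  lower-dimensional spikes.\<close>

definition solid_polytope :: "(real ^ 'n) set \<Rightarrow> bool" where
  "solid_polytope K \<longleftrightarrow>
     (\<exists>\<P>. finite \<P> \<and> \<P> \<noteq> {} \<and> (\<forall>P\<in>\<P>. polytope P \<and> interior P \<noteq> {}) \<and> K = \<Union>\<P>)"

text \<open>A unit vector \<open>n\<close> is the outward normal of \<open>K\<close> at \<open>x\<close> if near \<open>x\<close> the set \<open>K\<close> is the half-space
  with outward normal \<open>n\<close> whose boundary passes through \<open>x\<close>. Then \<open>x\<close> is a boundary point and \<open>n\<close> is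
  unique. For a polytope such an \<open>n\<close> exists at all boundary points outside a finite union of
  affine sets of codimension 2.\<close>

definition outward_unit_normal :: "(real ^ 'n) set \<Rightarrow> real ^ 'n \<Rightarrow> real ^ 'n \<Rightarrow> bool" where
  "outward_unit_normal K x n \<longleftrightarrow>
     norm n = 1 \<and> (\<exists>e>0. \<forall>y\<in>ball x e. y \<in> K \<longleftrightarrow> n \<bullet> (y - x) \<le> 0)"

definition star_regular_centered :: "(real ^ 'n) set \<Rightarrow> bool" where
  "star_regular_centered K \<longleftrightarrow>
     solid_polytope K \<and> starlike K \<and>
     (\<exists>c. \<forall>x n. outward_unit_normal K x n \<longrightarrow> n \<bullet> x = c)"


section \<open>Isometries\<close>

definition isometries_of :: "(real ^ 'n) set \<Rightarrow> (real ^ 'n \<Rightarrow> real ^ 'n) set" where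
  "isometries_of K = {f. (\<forall>x y. dist (f x) (f y) = dist x y) \<and> f ` K = K}"

definition isometry_orbit :: "(real ^ 'n) set \<Rightarrow> real ^ 'n \<Rightarrow> (real ^ 'n) set" where
  "isometry_orbit K x = {f x | f. f \<in> isometries_of K}"


section \<open>Polynomials\<close>

text \<open>Polynomial functions in \<open>CARD('n)\<close> variables of total degree at most \<open>k\<close>; the sum runs over
  the multi-indices \<open>\<alpha>\<close> of order at most \<open>k\<close>, of which there are finitely many.\<close>

definition poly_space :: "nat \<Rightarrow> (real ^ 'n \<Rightarrow> real) set" where
  "poly_space k =
     {U. \<exists>a. U = (\<lambda>x. \<Sum>\<alpha> | (\<Sum>i\<in>UNIV. \<alpha> i) \<le> k. a \<alpha> * (\<Prod>i\<in>UNIV. (x $ i) ^ \<alpha> i))}"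


section \<open>Averages over the cell and over its boundary\<close>

definition cell_average :: "(real ^ 'n) set \<Rightarrow> (real ^ 'n \<Rightarrow> real) \<Rightarrow> real" where
  "cell_average K U = (LINT x:K|lborel. U x) / measure lborel K"

text \<open>Lebesgue measure of dimension \<open>CARD('n) - 1\<close> on the hyperplane \<open>n \<bullet> x = c\<close> (for a unit vector
  \<open>n\<close>), expressed in Cartesian coordinates with respect to an orthonormal basis of the orthogonal
  complement of \<open>n\<close>. The result does not depend on the basis chosen. In dimension 1 the basis is
  empty and the measure is the unit mass at the point \<open>c *\<^sub>R n\<close>.\<close>

definition orthonormal_basis_perp :: "real ^ 'n \<Rightarrow> (real ^ 'n) set" where
  "orthonormal_basis_perp n =
     (SOME B. pairwise orthogonal B \<and> (\<forall>b\<in>B. norm b = 1) \<and> span B = {x. n \<bullet> x = 0})"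

definition hyperplane_measure :: "real ^ 'n \<Rightarrow> real \<Rightarrow> (real ^ 'n) measure" where
  "hyperplane_measure n c =
     distr (\<Pi>\<^sub>M b\<in>orthonormal_basis_perp n. lborel) borel
       (\<lambda>v. c *\<^sub>R n + (\<Sum>b\<in>orthonormal_basis_perp n. v b *\<^sub>R b))"

text \<open>The surface integral over the boundary of a polytope is the sum over the (finitely many)
  oriented hyperplanes carrying boundary facets. The boundary points without a normal are
  negligible for the surface measure and do not contribute. Keeping track of the orientation
  matters for non-convex polytopes, where facets with normals \<open>n\<close> and \<open>-n\<close> may be coplanar.\<close>

definition facet_planes :: "(real ^ 'n) set \<Rightarrow> ((real ^ 'n) \<times> real) set" where
  "facet_planes K = {(n, n \<bullet> x) | n x. outward_unit_normal K x n}"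

definition facet_points :: "(real ^ 'n) set \<Rightarrow> real ^ 'n \<Rightarrow> real \<Rightarrow> (real ^ 'n) set" where
  "facet_points K n c = {x. outward_unit_normal K x n \<and> n \<bullet> x = c}"

definition boundary_integral :: "(real ^ 'n) set \<Rightarrow> (real ^ 'n \<Rightarrow> real) \<Rightarrow> real" where
  "boundary_integral K U =
     (\<Sum>(n, c)\<in>facet_planes K. LINT x:facet_points K n c|hyperplane_measure n c. U x)"

definition boundary_average :: "(real ^ 'n) set \<Rightarrow> (real ^ 'n \<Rightarrow> real) \<Rightarrow> real" where
  "boundary_average K U = boundary_integral K U / boundary_integral K (\<lambda>_. 1)"

definition quadrature :: "(real ^ 'n) set \<Rightarrow> (real ^ 'n \<Rightarrow> real) \<Rightarrow> (real ^ 'n \<Rightarrow> real) \<Rightarrow> real" where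
  "quadrature Q b g = (\<Sum>x\<in>Q. b x * g x)"

definition boundary_quadrature ::
  "(real ^ 'n) set \<Rightarrow> (real ^ 'n \<Rightarrow> real) set \<Rightarrow> (real ^ 'n) set \<Rightarrow> (real ^ 'n \<Rightarrow> real) \<Rightarrow> bool" where
  "boundary_quadrature K V Q b \<longleftrightarrow>
     finite Q \<and> Q \<subseteq> frontier K \<and> (\<forall>x\<in>Q. b x > 0) \<and>
     (\<forall>U\<in>V. quadrature Q b U = boundary_average K U)"


section \<open>Optimal interior weight and retentional\<close>

definition weight_ratios :: "(real ^ 'n) set \<Rightarrow> (real ^ 'n \<Rightarrow> real) set \<Rightarrow> real set" where
  "weight_ratios K V =
     {boundary_average K U / cell_average K U | U.
        U \<in> V \<and> (\<forall>x\<in>K. U x \<ge> 0) \<and> cell_average K U > 0}"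

text \<open>Meaningful only if \<open>weight_ratios K V\<close> is nonempty and bounded above.\<close>

definition optimal_weight :: "(real ^ 'n) set \<Rightarrow> (real ^ 'n \<Rightarrow> real) set \<Rightarrow> real" where
  "optimal_weight K V = Sup (weight_ratios K V)"

definition retentional ::
  "(real ^ 'n) set \<Rightarrow> (real ^ 'n \<Rightarrow> real) set \<Rightarrow> (real ^ 'n \<Rightarrow> real) \<Rightarrow> real" where
  "retentional K V U = optimal_weight K V * cell_average K U - boundary_average K U"

end

theory Submission
  imports Defs
begin

text \<open>
  Write \<open>D\<close> for the dimension, \<open>C\<close> for the cell average and \<open>B\<close> for the boundary average. Everything
  follows from the identity \<open>B(U) = (D + 2)/D C(U) - 2/D U(0)\<close> for quadratic \<open>U\<close>, which is
  \<open>boundary_average_poly_2\<close>. It says that the retentional with weight \<open>M = (D + 2)/D\<close> is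
  \<open>2/D U(0)\<close>. As \<open>0 \<in> K\<close>, a polynomial that is nonnegative in \<open>K\<close> satisfies \<open>B(U) \<le> M C(U)\<close>, with
  equality for the square of a coordinate, so \<open>M\<close> is the optimal weight. For the Euler step,
  with \<open>B\<close> computed by the quadrature, \<open>\<Delta>t B(h) \<le> \<mu> \<Delta>t B(U) \<le> B(U)/M \<le> C(U)\<close>.

  The identity is the divergence theorem for the vector field \<open>x \<mapsto> U(x) x\<close>, and in the present case it
  can be obtained from Fubini's theorem alone. All facets have the same distance \<open>c\<close> from the origin,
  and up to a null set \<open>K\<close> is the disjoint union of the cones with apex \<open>0\<close> over its facets
  (\<open>star_regular_cone_decomposition\<close>). If \<open>U\<close> is positively homogeneous of degree \<open>k\<close>, then slicing
  the cone over a facet \<open>F\<close> by the hyperplanes parallel to \<open>F\<close> at distance \<open>s\<close> from the origin gives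
  the integral of \<open>U\<close> over the cone as \<open>\<integral>\<^sub>0\<^sup>c (s/c)\<^sup>D\<^sup>-\<^sup>1\<^sup>+\<^sup>k ds = c/(D + k)\<close> times its integral over \<open>F\<close>
  (\<open>nn_integral_facet_cone\<close>). Summing over the facets and dividing by the case \<open>U = 1\<close> yields
  \<open>B(U) = (D + k)/D C(U)\<close>. A quadratic polynomial is a sum of parts of degree \<open>0\<close>, \<open>1\<close> and \<open>2\<close>; the
  linear part has average \<open>0\<close> because the centroid of \<open>K\<close> is fixed by all isometries of \<open>K\<close> and hence
  is the origin.

  The cones require the origin to be a star center of \<open>K\<close>, whereas star-convexity provides only some
  star center. The star centers form a nonempty closed convex set which the isometries of \<open>K\<close> leave
  invariant. They fix the origin, so they also fix the star center closest to the origin, which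
  therefore is the origin itself (\<open>star_center_at_origin\<close>).
\<close>

section \<open>Rotation invariance of Lebesgue measure\<close>

lemma nn_integral_lborel_reflect:
  fixes g :: "'a :: euclidean_space \<Rightarrow> ennreal"
  assumes [measurable]: "g \<in> borel_measurable borel"
  shows "(\<integral>\<^sup>+y. g (a - y) \<partial>lborel) = (\<integral>\<^sup>+y. g y \<partial>lborel)"
proof -
  have "lborel = distr lborel borel (\<lambda>x. a - x :: 'a)"
    using lborel_affine[of "-1" a] by (simp add: density_1)
  then have "(\<integral>\<^sup>+y. g y \<partial>lborel) = (\<integral>\<^sup>+y. g y \<partial>distr lborel borel (\<lambda>x. a - x :: 'a))"
    by simp
  then show ?thesis by (simp add: nn_integral_distr)
qed

lemma nn_integral_lborel_translate:
  fixes g :: "'a :: euclidean_space \<Rightarrow> ennreal"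
  assumes [measurable]: "g \<in> borel_measurable borel"
  shows "(\<integral>\<^sup>+y. g (a + y) \<partial>lborel) = (\<integral>\<^sup>+y. g y \<partial>lborel)"
proof -
  have "(\<integral>\<^sup>+y. g y \<partial>lborel) = (\<integral>\<^sup>+y. g y \<partial>distr lborel borel ((+) a))"
    by (simp add: lborel_distr_plus)
  then show ?thesis by (simp add: nn_integral_distr)
qed

lemma borel_measurable_orthogonal_transformation:
  fixes f :: "'a :: euclidean_space \<Rightarrow> 'a"
  assumes "orthogonal_transformation f"
  shows "f \<in> borel_measurable borel"
  by (intro borel_measurable_continuous_onI linear_continuous_on
        linear_conv_bounded_linear[THEN iffD1] orthogonal_transformation_linear assms)

text \<open>The image measure is translation invariant, and translation-invariant measures are
  proportional: in the integral of \<open>1\<^sub>A (f x) 1\<^sub>B (y)\<close> over \<open>(x, y)\<close>, the substitutions \<open>y \<mapsto> f x + y\<close> and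
  \<open>x \<mapsto> x - f\<^sup>-\<^sup>1 y\<close> exchange the roles of \<open>A\<close> and \<open>B\<close>. Taking for \<open>B\<close> the unit ball, which \<open>f\<close> preserves,
  shows that the factor is 1.\<close>
lemma distr_lborel_orthogonal_transformation:
  fixes f :: "'a :: euclidean_space \<Rightarrow> 'a"
  assumes f: "orthogonal_transformation f"
  shows "distr lborel borel f = lborel"
proof (rule measure_eqI)
  note [measurable] = borel_measurable_orthogonal_transformation[OF f]
  define g where "g = inv f"
  have g: "orthogonal_transformation g"
    unfolding g_def using f by (rule orthogonal_transformation_inv)
  note [measurable] = borel_measurable_orthogonal_transformation[OF g]
  have fg: "f (g y) = y" for y
    by (simp add: g_def surj_f_inv_f orthogonal_transformation_surj[OF f])
  have lin: "f (x - g y) = f x - y" for x y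
    using linear_diff[OF orthogonal_transformation_linear[OF f]] by (simp add: fg)
  define B where "B = ball (0::'a) 1"
  have [measurable]: "B \<in> sets borel" by (simp add: B_def)
  fix A assume "A \<in> sets (distr lborel borel f)"
  then have A[measurable]: "A \<in> sets borel" by simp
  let ?m = "\<lambda>S. emeasure lborel (S :: 'a set)"
  have vim: "?m (f -` S) = (\<integral>\<^sup>+x. indicator S (f x) \<partial>lborel)" if [measurable]: "S \<in> sets borel" for S
  proof -
    have "?m (f -` S) = (\<integral>\<^sup>+x. indicator (f -` S) x \<partial>lborel)"
      using measurable_sets[OF borel_measurable_orthogonal_transformation[OF f] that] by simp
    then show ?thesis by (simp add: indicator_def)
  qed
  have "?m (f -` A) * ?m B = (\<integral>\<^sup>+x. indicator A (f x) * (\<integral>\<^sup>+y. indicator B y \<partial>lborel) \<partial>lborel)"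
    by (subst vim) (simp_all add: nn_integral_multc)
  also have "\<dots> = (\<integral>\<^sup>+x. indicator A (f x) * (\<integral>\<^sup>+y. indicator B (f x + y) \<partial>lborel) \<partial>lborel)"
    by (subst nn_integral_lborel_translate) simp_all
  also have "\<dots> = (\<integral>\<^sup>+x. (\<integral>\<^sup>+y. indicator A (f x) * indicator B (f x + y) \<partial>lborel) \<partial>lborel)"
    by (intro nn_integral_cong nn_integral_cmult[symmetric]) measurable
  also have "\<dots> = (\<integral>\<^sup>+y. (\<integral>\<^sup>+x. indicator A (f x) * indicator B (f x + y) \<partial>lborel) \<partial>lborel)"
    by (rule lborel_pair.Fubini'[symmetric]) measurable
  also have "\<dots> = (\<integral>\<^sup>+y. (\<integral>\<^sup>+x. indicator A (f (- g y + x)) * indicator B (f (- g y + x) + y) \<partial>lborel) \<partial>lborel)"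
    by (intro nn_integral_cong nn_integral_lborel_translate[symmetric]) measurable
  also have "\<dots> = (\<integral>\<^sup>+y. (\<integral>\<^sup>+x. indicator A (f x - y) * indicator B (f x) \<partial>lborel) \<partial>lborel)"
    by (simp add: lin)
  also have "\<dots> = (\<integral>\<^sup>+x. (\<integral>\<^sup>+y. indicator A (f x - y) * indicator B (f x) \<partial>lborel) \<partial>lborel)"
    by (rule lborel_pair.Fubini') measurable
  also have "\<dots> = (\<integral>\<^sup>+x. (\<integral>\<^sup>+y. indicator A (f x - y) \<partial>lborel) * indicator B (f x) \<partial>lborel)"
    by (intro nn_integral_cong nn_integral_multc) measurable
  also have "\<dots> = (\<integral>\<^sup>+x. ?m A * indicator B (f x) \<partial>lborel)"
    by (subst nn_integral_lborel_reflect) simp_all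
  also have "\<dots> = ?m A * ?m (f -` B)"
    by (subst vim) (simp_all add: nn_integral_cmult)
  also have "f -` B = B"
    using orthogonal_transformation_norm[OF f] by (auto simp: B_def)
  finally have eq: "?m (f -` A) * ?m B = ?m A * ?m B" .
  have "?m B \<noteq> \<infinity>" using emeasure_lborel_ball_finite[of "0::'a" 1] by (metis B_def less_irrefl infinity_ennreal_def)
  moreover have "?m B \<noteq> 0"
    using content_ball_pos[of 1 "0::'a"] by (auto simp: B_def measure_def)
  ultimately have "?m (f -` A) = ?m A"
    using eq by (simp add: mult.commute[of _ "?m B"] ennreal_mult_cancel_left)
  then show "emeasure (distr lborel borel f) A = ?m A"
    by (simp add: emeasure_distr)
qed simp

text \<open>Lebesgue measure is defined through the standard basis. Any other orthonormal basis is the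
  image of the standard one under an orthogonal map, so it leads to the same measure.\<close>
lemma distr_PiM_orthonormal_basis:
  fixes E :: "(real ^ 'n) set"
  assumes fin: "finite E" and card: "card E = CARD('n)" and orth: "pairwise orthogonal E"
    and unit: "\<And>b. b \<in> E \<Longrightarrow> norm b = 1"
  shows "distr (\<Pi>\<^sub>M b\<in>E. lborel) borel (\<lambda>v. \<Sum>b\<in>E. v b *\<^sub>R b) = lborel"
proof -
  interpret product_sigma_finite "\<lambda>_::real^'n. lborel :: real measure" ..
  obtain \<tau> :: "real^'n \<Rightarrow> real^'n" where \<tau>: "bij_betw \<tau> Basis E"
    using fin card finite_same_card_bij[of "Basis :: (real^'n) set" E] by auto
  define T where "T x = (\<Sum>i\<in>Basis. (x \<bullet> i) *\<^sub>R \<tau> i)" for x :: "real^'n"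
  \<comment> \<open>\<open>R\<close> replaces each \<open>b \<in> E\<close> by the standard basis vector that \<open>T\<close> maps to \<open>b\<close>; preimages of boxes
    under \<open>R\<close> are products of intervals.\<close>
  define R where "R v = (\<Sum>i\<in>Basis. v (\<tau> i) *\<^sub>R i)" for v :: "real^'n \<Rightarrow> real"
  have inner_\<tau>: "\<tau> i \<bullet> \<tau> j = (if i = j then 1 else 0)" if "i \<in> Basis" "j \<in> Basis" for i j
  proof -
    have "\<tau> i \<in> E" "\<tau> j \<in> E" using \<tau> that by (auto simp: bij_betw_def)
    moreover have "\<tau> i = \<tau> j \<longleftrightarrow> i = j" using \<tau> that by (auto simp: bij_betw_def inj_on_def)
    ultimately show ?thesis
      using orth unit[of "\<tau> i"] by (auto simp: pairwise_def orthogonal_def dot_square_norm)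
  qed
  have T: "orthogonal_transformation T"
    unfolding orthogonal_transformation_def
  proof (intro conjI allI)
    show "linear T"
      by (auto simp: T_def linear_iff inner_add_left scaleR_add_left sum.distrib scaleR_sum_right)
    show "T v \<bullet> T w = v \<bullet> w" for v w
      by (simp add: T_def inner_sum_left inner_sum_right inner_\<tau> if_distrib
          euclidean_inner[of v w] mult.commute cong: if_cong)
  qed
  have Rm: "R \<in> measurable (\<Pi>\<^sub>M b\<in>E. lborel) borel"
  proof -
    have "(\<lambda>v. v (\<tau> i)) \<in> borel_measurable (\<Pi>\<^sub>M b\<in>E. lborel)" if "i \<in> Basis" for i
      using measurable_component_singleton[of "\<tau> i" E "\<lambda>_. lborel"] \<tau> that
      by (auto simp: bij_betw_def)
    then show ?thesis unfolding R_def by measurable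
  qed
  have "distr (\<Pi>\<^sub>M b\<in>E. lborel) borel R = lborel"
  proof (rule lborel_eqI [symmetric])
    fix l u :: "real^'n"
    assume lu: "\<And>b. b\<in>Basis \<Longrightarrow> l \<bullet> b \<le> u \<bullet> b"
    define \<sigma> where "\<sigma> = inv_into Basis \<tau>"
    have \<sigma>: "\<sigma> (\<tau> i) = i" if "i \<in> Basis" for i
      using \<tau> that by (auto simp: \<sigma>_def bij_betw_def)
    have Rc: "R v \<bullet> i = v (\<tau> i)" if "i \<in> Basis" for v i
      using that by (simp add: R_def inner_sum_left inner_Basis if_distrib cong: if_cong)
    have E: "E = \<tau> ` Basis" and inj: "inj_on \<tau> Basis" using \<tau> by (auto simp: bij_betw_def)
    have "R -` box l u \<inter> space (\<Pi>\<^sub>M b\<in>E. lborel) = Pi\<^sub>E E (\<lambda>b. {l \<bullet> \<sigma> b <..< u \<bullet> \<sigma> b})"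
      by (auto simp: space_PiM PiE_iff mem_box Rc E \<sigma>)
    then have "emeasure (distr (\<Pi>\<^sub>M b\<in>E. lborel) borel R) (box l u)
        = emeasure (\<Pi>\<^sub>M b\<in>E. lborel) (Pi\<^sub>E E (\<lambda>b. {l \<bullet> \<sigma> b <..< u \<bullet> \<sigma> b}))"
      using Rm by (simp add: emeasure_distr)
    also have "\<dots> = (\<Prod>b\<in>E. emeasure lborel {l \<bullet> \<sigma> b <..< u \<bullet> \<sigma> b})"
      using fin by (intro emeasure_PiM) auto
    also have "\<dots> = (\<Prod>i\<in>Basis. emeasure lborel {l \<bullet> i <..< u \<bullet> i})"
      unfolding E using \<sigma> by (simp add: prod.reindex[OF inj])
    also have "\<dots> = (\<Prod>i\<in>Basis. ennreal ((u - l) \<bullet> i))"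
      using lu by (intro prod.cong) (auto simp: inner_diff_left)
    also have "\<dots> = ennreal (\<Prod>i\<in>Basis. (u - l) \<bullet> i)"
      using lu by (intro prod_ennreal) (auto simp: inner_diff_left)
    finally show "emeasure (distr (\<Pi>\<^sub>M b\<in>E. lborel) borel R) (box l u)
        = ennreal (\<Prod>i\<in>Basis. (u - l) \<bullet> i)" .
  qed simp
  moreover have "(\<lambda>v. \<Sum>b\<in>E. v b *\<^sub>R b) = T \<circ> R"
  proof
    fix v :: "real^'n \<Rightarrow> real"
    have E: "E = \<tau> ` Basis" and inj: "inj_on \<tau> Basis" using \<tau> by (auto simp: bij_betw_def)
    show "(\<Sum>b\<in>E. v b *\<^sub>R b) = (T \<circ> R) v"
      unfolding E T_def R_def
      by (simp add: sum.reindex[OF inj] inner_sum_left inner_Basis if_distrib cong: if_cong)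
  qed
  moreover have "T \<in> borel_measurable borel"
    using T by (rule borel_measurable_orthogonal_transformation)
  ultimately show ?thesis
    using distr_lborel_orthogonal_transformation[OF T] distr_distr[of T borel borel R "\<Pi>\<^sub>M b\<in>E. lborel"] Rm
    by simp
qed

text \<open>The Jacobian of a homothety on a product of lines, one factor \<open>t\<close> per coordinate.\<close>
lemma nn_integral_PiM_scale:
  fixes f :: "('i \<Rightarrow> real) \<Rightarrow> ennreal"
  assumes "finite I" "t > 0" "f \<in> borel_measurable (\<Pi>\<^sub>M i\<in>I. lborel)"
  shows "(\<integral>\<^sup>+v. f v \<partial>(\<Pi>\<^sub>M i\<in>I. lborel))
    = ennreal (t ^ card I) * (\<integral>\<^sup>+v. f (\<lambda>i\<in>I. t * v i) \<partial>(\<Pi>\<^sub>M i\<in>I. lborel))"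
  using assms
proof (induction I arbitrary: f rule: finite_induct)
  case empty
  interpret product_sigma_finite "\<lambda>_::'i. lborel :: real measure" ..
  show ?case
    by (simp add: nn_integral_empty del: nn_integral_const)
next
  case (insert i I)
  interpret product_sigma_finite "\<lambda>_::'i. lborel :: real measure" ..
  note [measurable] = insert.prems(2)
  have m: "(\<lambda>x. \<integral>\<^sup>+y. f (x(i := y)) \<partial>lborel) \<in> borel_measurable (\<Pi>\<^sub>M i\<in>I. lborel)"
    by measurable
  have "(\<integral>\<^sup>+v. f v \<partial>(\<Pi>\<^sub>M i\<in>insert i I. lborel)) = (\<integral>\<^sup>+x. \<integral>\<^sup>+y. f (x(i := y)) \<partial>lborel \<partial>(\<Pi>\<^sub>M i\<in>I. lborel))"
    using insert by (intro product_nn_integral_insert) auto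
  also have "\<dots> = ennreal (t ^ card I) * (\<integral>\<^sup>+x. \<integral>\<^sup>+y. f ((\<lambda>i\<in>I. t * x i)(i := y)) \<partial>lborel \<partial>(\<Pi>\<^sub>M i\<in>I. lborel))"
    by (rule insert.IH[OF insert.prems(1) m])
  also have "(\<integral>\<^sup>+x. \<integral>\<^sup>+y. f ((\<lambda>i\<in>I. t * x i)(i := y)) \<partial>lborel \<partial>(\<Pi>\<^sub>M i\<in>I. lborel))
    = (\<integral>\<^sup>+x. ennreal t * (\<integral>\<^sup>+y. f ((\<lambda>i\<in>I. t * x i)(i := t * y)) \<partial>lborel) \<partial>(\<Pi>\<^sub>M i\<in>I. lborel))"
  proof (rule nn_integral_cong)
    fix x :: "'i \<Rightarrow> real" assume "x \<in> space (\<Pi>\<^sub>M i\<in>I. lborel)"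
    have "(\<lambda>i\<in>I. t * x i) \<in> space (\<Pi>\<^sub>M i\<in>I. lborel)" by (simp add: space_PiM)
    then have "(\<lambda>y. f ((\<lambda>i\<in>I. t * x i)(i := y))) \<in> borel_measurable lborel"
      using insert.hyps
      by (intro measurable_compose[OF measurable_component_update[of _ I "\<lambda>_. lborel" i] insert.prems(2)])
    then have "(\<lambda>y. f ((\<lambda>i\<in>I. t * x i)(i := y))) \<in> borel_measurable borel"
      by (rule subst[where P = "\<lambda>M. _ \<in> M", rotated]) (rule measurable_cong_sets; simp)
    from nn_integral_real_affine[OF this, of t 0] insert.prems(1)
    show "(\<integral>\<^sup>+y. f ((\<lambda>i\<in>I. t * x i)(i := y)) \<partial>lborel) = ennreal t * (\<integral>\<^sup>+y. f ((\<lambda>i\<in>I. t * x i)(i := t * y)) \<partial>lborel)"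
      by simp
  qed
  also have "\<dots> = (\<integral>\<^sup>+x. ennreal t * (\<integral>\<^sup>+y. f (\<lambda>j\<in>insert i I. t * (x(i := y)) j) \<partial>lborel) \<partial>(\<Pi>\<^sub>M i\<in>I. lborel))"
  proof -
    have "(\<lambda>i\<in>I. t * x i)(i := t * y) = (\<lambda>j\<in>insert i I. t * (x(i := y)) j)" for x y
      using insert.hyps by (auto simp: fun_eq_iff)
    then show ?thesis by simp
  qed
  also have "\<dots> = ennreal t * (\<integral>\<^sup>+x. (\<integral>\<^sup>+y. f (\<lambda>j\<in>insert i I. t * (x(i := y)) j) \<partial>lborel) \<partial>(\<Pi>\<^sub>M i\<in>I. lborel))"
    by (rule nn_integral_cmult) measurable
  also have "(\<integral>\<^sup>+x. (\<integral>\<^sup>+y. f (\<lambda>j\<in>insert i I. t * (x(i := y)) j) \<partial>lborel) \<partial>(\<Pi>\<^sub>M i\<in>I. lborel))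
     = (\<integral>\<^sup>+v. f (\<lambda>j\<in>insert i I. t * v j) \<partial>(\<Pi>\<^sub>M i\<in>insert i I. lborel))"
    using insert.hyps by (intro product_nn_integral_insert[symmetric]) auto
  finally have "(\<integral>\<^sup>+v. f v \<partial>(\<Pi>\<^sub>M i\<in>insert i I. lborel)) = ennreal (t ^ card I) *
      (ennreal t * (\<integral>\<^sup>+v. f (\<lambda>j\<in>insert i I. t * v j) \<partial>(\<Pi>\<^sub>M i\<in>insert i I. lborel)))" .
  moreover have "ennreal (t ^ card (insert i I)) = ennreal (t ^ card I) * ennreal t"
    using insert by (simp add: ennreal_mult mult.commute)
  ultimately show ?case by (simp only: mult.assoc)
qed

section \<open>Slicing by parallel hyperplanes\<close>

lemma orthonormal_basis_perp:
  fixes n :: "real ^ 'n"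
  assumes "norm n = 1"
  shows "finite (orthonormal_basis_perp n)"
    and "card (orthonormal_basis_perp n) = CARD('n) - 1"
    and "pairwise orthogonal (orthonormal_basis_perp n)"
    and "\<And>b. b \<in> orthonormal_basis_perp n \<Longrightarrow> norm b = 1 \<and> n \<bullet> b = 0"
    and "n \<notin> orthonormal_basis_perp n"
proof -
  define B where "B = orthonormal_basis_perp n"
  have "\<exists>B. pairwise orthogonal B \<and> (\<forall>b\<in>B. norm b = 1) \<and> span B = {x. n \<bullet> x = 0}"
    by (rule orthonormal_basis_subspace[OF subspace_hyperplane[of n]]) metis
  then have "pairwise orthogonal B \<and> (\<forall>b\<in>B. norm b = 1) \<and> span B = {x. n \<bullet> x = 0}"
    unfolding B_def orthonormal_basis_perp_def by (rule someI_ex)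
  then have B: "pairwise orthogonal B" "\<And>b. b \<in> B \<Longrightarrow> norm b = 1" "span B = {x. n \<bullet> x = 0}"
    by auto
  have perp: "n \<bullet> b = 0" if "b \<in> B" for b
    using B(3) span_superset[of B] that by auto
  have ind: "independent B"
    using B(1,2) by (intro pairwise_orthogonal_independent) (auto dest: B(2))
  have "card B = dim (span B)" using ind by (simp add: indep_card_eq_dim_span)
  also have "\<dots> = CARD('n) - 1" proof -
    have "n \<noteq> 0" using assms by auto
    then show ?thesis using B(3) dim_hyperplane[of n] by simp
  qed
  finally show "card (orthonormal_basis_perp n) = CARD('n) - 1" by (simp add: B_def)
  show "finite (orthonormal_basis_perp n)" "pairwise orthogonal (orthonormal_basis_perp n)"
    "n \<notin> orthonormal_basis_perp n"
    "\<And>b. b \<in> orthonormal_basis_perp n \<Longrightarrow> norm b = 1 \<and> n \<bullet> b = 0"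
    using B ind perp[of n] perp assms independent_imp_finite[of B]
    by (auto simp: B_def[symmetric] norm_eq_1)
qed

lemma space_hyperplane_measure [simp]: "space (hyperplane_measure n c) = UNIV"
  and sets_hyperplane_measure [simp, measurable_cong]: "sets (hyperplane_measure n c) = sets borel"
  by (simp_all add: hyperplane_measure_def)

lemma borel_measurable_PiM_sum_scaleR:
  fixes B :: "(real ^ 'n) set"
  shows "(\<lambda>v. \<Sum>b\<in>B. v b *\<^sub>R b) \<in> borel_measurable (\<Pi>\<^sub>M b\<in>B. (lborel :: real measure))"
proof -
  have "(\<lambda>v. v b) \<in> borel_measurable (\<Pi>\<^sub>M b\<in>B. (lborel :: real measure))" if "b \<in> B" for b
    using measurable_component_singleton[of b B "\<lambda>_. lborel"] that by simp
  then show ?thesis by measurable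
qed

lemma nn_integral_hyperplane_measure:
  fixes g :: "real ^ 'n \<Rightarrow> ennreal"
  assumes [measurable]: "g \<in> borel_measurable borel"
  shows "(\<integral>\<^sup>+x. g x \<partial>hyperplane_measure n c)
    = (\<integral>\<^sup>+v. g (c *\<^sub>R n + (\<Sum>b\<in>orthonormal_basis_perp n. v b *\<^sub>R b))
        \<partial>(\<Pi>\<^sub>M b\<in>orthonormal_basis_perp n. lborel))"
proof -
  note [measurable] = borel_measurable_PiM_sum_scaleR[of "orthonormal_basis_perp n"]
  show ?thesis
    unfolding hyperplane_measure_def by (subst nn_integral_distr) measurable
qed

text \<open>The measure is carried by its hyperplane, so only the values there matter.\<close>
lemma nn_integral_hyperplane_measure_cong:
  assumes n: "norm n = 1" and [measurable]: "f \<in> borel_measurable borel" "g \<in> borel_measurable borel"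
    and eq: "\<And>x. n \<bullet> x = c \<Longrightarrow> f x = g x"
  shows "(\<integral>\<^sup>+x. f x \<partial>hyperplane_measure n c) = (\<integral>\<^sup>+x. g x \<partial>hyperplane_measure n c)"
proof -
  have "n \<bullet> (c *\<^sub>R n + (\<Sum>b\<in>orthonormal_basis_perp n. v b *\<^sub>R b)) = c" for v
    using orthonormal_basis_perp(4)[OF n] n by (simp add: inner_add_right inner_sum_right norm_eq_1)
  then show ?thesis
    by (simp add: nn_integral_hyperplane_measure eq)
qed

text \<open>Fubini's theorem in an orthonormal basis containing \<open>n\<close>.\<close>
lemma nn_integral_lborel_slices:
  fixes g :: "real ^ 'n \<Rightarrow> ennreal"
  assumes n: "norm n = 1" and g[measurable]: "g \<in> borel_measurable borel"
  shows "(\<integral>\<^sup>+x. g x \<partial>lborel) = (\<integral>\<^sup>+s. (\<integral>\<^sup>+x. g x \<partial>hyperplane_measure n s) \<partial>lborel)"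
proof -
  interpret product_sigma_finite "\<lambda>_::real^'n. lborel :: real measure" ..
  define B where "B = orthonormal_basis_perp n"
  note B = orthonormal_basis_perp[OF n, folded B_def]
  let ?E = "insert n B"
  note [measurable] = borel_measurable_PiM_sum_scaleR[of ?E]
  have sum: "(\<Sum>b\<in>?E. (v(n := s)) b *\<^sub>R b) = s *\<^sub>R n + (\<Sum>b\<in>B. v b *\<^sub>R b)" for v s
  proof -
    have "(\<Sum>b\<in>B. (v(n := s)) b *\<^sub>R b) = (\<Sum>b\<in>B. v b *\<^sub>R b)"
      using B(5) by (intro sum.cong) auto
    then show ?thesis using B(1,5) by simp
  qed
  have "card ?E = CARD('n)"
    using B(1,2,5) by simp
  moreover have "pairwise orthogonal ?E"
    using B(3,4) by (auto simp: pairwise_insert orthogonal_def inner_commute)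
  ultimately have "(\<integral>\<^sup>+x. g x \<partial>lborel)
      = (\<integral>\<^sup>+x. g x \<partial>distr (\<Pi>\<^sub>M b\<in>?E. lborel) borel (\<lambda>v. \<Sum>b\<in>?E. v b *\<^sub>R b))"
    using B(1,4) n by (subst distr_PiM_orthonormal_basis) auto
  also have "\<dots> = (\<integral>\<^sup>+v. g (\<Sum>b\<in>?E. v b *\<^sub>R b) \<partial>(\<Pi>\<^sub>M b\<in>?E. lborel))"
    by (rule nn_integral_distr) measurable
  also have "\<dots> = (\<integral>\<^sup>+s. (\<integral>\<^sup>+v. g (\<Sum>b\<in>?E. (v(n := s)) b *\<^sub>R b) \<partial>(\<Pi>\<^sub>M b\<in>B. lborel)) \<partial>lborel)"
    using B(1,5) by (intro product_nn_integral_insert_rev) auto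
  finally show ?thesis
    unfolding sum by (simp add: nn_integral_hyperplane_measure B_def)
qed

lemma nn_integral_hyperplane_measure_scale:
  fixes g :: "real ^ 'n \<Rightarrow> ennreal"
  assumes n: "norm n = 1" and [measurable]: "g \<in> borel_measurable borel" and t: "t > 0"
  shows "(\<integral>\<^sup>+x. g x \<partial>hyperplane_measure n (t * c))
    = ennreal (t ^ (CARD('n) - 1)) * (\<integral>\<^sup>+x. g (t *\<^sub>R x) \<partial>hyperplane_measure n c)"
proof -
  define B where "B = orthonormal_basis_perp n"
  note B = orthonormal_basis_perp[OF n, folded B_def]
  note [measurable] = borel_measurable_PiM_sum_scaleR[of B]
  have "(\<integral>\<^sup>+x. g x \<partial>hyperplane_measure n (t * c))
      = (\<integral>\<^sup>+v. g ((t * c) *\<^sub>R n + (\<Sum>b\<in>B. v b *\<^sub>R b)) \<partial>(\<Pi>\<^sub>M b\<in>B. lborel))"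
    unfolding B_def by (rule nn_integral_hyperplane_measure) measurable
  also have "\<dots> = ennreal (t ^ card B) *
      (\<integral>\<^sup>+v. g ((t * c) *\<^sub>R n + (\<Sum>b\<in>B. (\<lambda>b\<in>B. t * v b) b *\<^sub>R b)) \<partial>(\<Pi>\<^sub>M b\<in>B. lborel))"
    using B(1) t by (intro nn_integral_PiM_scale) measurable
  also have "(\<lambda>v. (t * c) *\<^sub>R n + (\<Sum>b\<in>B. (\<lambda>b\<in>B. t * v b) b *\<^sub>R b))
      = (\<lambda>v. t *\<^sub>R (c *\<^sub>R n + (\<Sum>b\<in>B. v b *\<^sub>R b)))"
    by (simp add: scaleR_add_right scaleR_sum_right)
  also have "(\<integral>\<^sup>+v. g (t *\<^sub>R (c *\<^sub>R n + (\<Sum>b\<in>B. v b *\<^sub>R b))) \<partial>(\<Pi>\<^sub>M b\<in>B. lborel))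
      = (\<integral>\<^sup>+x. g (t *\<^sub>R x) \<partial>hyperplane_measure n c)"
    unfolding B_def by (rule nn_integral_hyperplane_measure[symmetric]) measurable
  finally show ?thesis by (simp add: B(2))
qed

text \<open>For \<open>F\<close> in the hyperplane \<open>n \<bullet> x = c\<close> with \<open>c > 0\<close>, this is the union of the segments from the origin to the
  points of \<open>F\<close>, without the origin. The description by the central projection onto the hyperplane makes
  its measurability evident.\<close>
definition facet_cone :: "real ^ 'n \<Rightarrow> real \<Rightarrow> (real ^ 'n) set \<Rightarrow> (real ^ 'n) set" where
  "facet_cone n c F = {x. 0 < n \<bullet> x \<and> n \<bullet> x \<le> c \<and> (c / (n \<bullet> x)) *\<^sub>R x \<in> F}"

lemma borel_facet_cone [measurable]:
  assumes [measurable]: "F \<in> sets borel"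
  shows "facet_cone n c F \<in> sets borel"
  unfolding facet_cone_def by measurable

text \<open>The slice of the cone at height \<open>s\<close> is the slice at height \<open>c\<close> scaled by \<open>s/c\<close>. Scaling contributes
  the factor \<open>(s/c)\<^sup>D\<^sup>-\<^sup>1\<close> from the measure and \<open>(s/c)\<^sup>k\<close> from the homogeneity of \<open>g\<close>, and integrating over
  \<open>s\<close> gives \<open>c/(D + k)\<close>. With values in \<open>ennreal\<close>, the formula also serves to derive integrability on
  the facets from integrability on the cell.\<close>
lemma nn_integral_facet_cone:
  fixes g :: "real ^ 'n \<Rightarrow> ennreal"
  assumes n: "norm n = 1" and c: "c > 0"
    and g[measurable]: "g \<in> borel_measurable borel"
    and hom: "\<And>t x. t > 0 \<Longrightarrow> g (t *\<^sub>R x) = ennreal (t ^ k) * g x"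
    and F[measurable]: "F \<in> sets borel"
  shows "(\<integral>\<^sup>+x. g x * indicator (facet_cone n c F) x \<partial>lborel)
    = ennreal (c / real (CARD('n) + k)) * (\<integral>\<^sup>+x. g x * indicator F x \<partial>hyperplane_measure n c)"
proof -
  let ?C = "facet_cone n c F"
  let ?J = "\<integral>\<^sup>+x. g x * indicator F x \<partial>hyperplane_measure n c"
  define m where "m = CARD('n) - 1 + k"
  have m: "real m + 1 = real (CARD('n) + k)"
    using zero_less_card_finite[where 'a='n] by (simp add: m_def del: zero_less_card_finite)
  have slice: "(\<integral>\<^sup>+x. g x * indicator ?C x \<partial>hyperplane_measure n s)
      = ennreal ((s / c) ^ m) * indicator {0..c} s * ?J" if "s \<noteq> 0" for s
  proof (cases "0 < s \<and> s \<le> c")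
    case True
    define t where "t = s / c"
    have t: "t > 0" "s = t * c" "t \<le> 1" using True c by (auto simp: t_def)
    have "(\<integral>\<^sup>+x. g x * indicator ?C x \<partial>hyperplane_measure n s)
        = ennreal (t ^ (CARD('n) - 1)) * (\<integral>\<^sup>+x. g (t *\<^sub>R x) * indicator ?C (t *\<^sub>R x) \<partial>hyperplane_measure n c)"
      unfolding t(2) using n t by (intro nn_integral_hyperplane_measure_scale) measurable
    also have "(\<integral>\<^sup>+x. g (t *\<^sub>R x) * indicator ?C (t *\<^sub>R x) \<partial>hyperplane_measure n c)
        = (\<integral>\<^sup>+x. ennreal (t ^ k) * (g x * indicator F x) \<partial>hyperplane_measure n c)"
    proof (rule nn_integral_hyperplane_measure_cong[OF n])
      fix x assume x: "n \<bullet> x = c"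
      then have "t *\<^sub>R x \<in> ?C \<longleftrightarrow> x \<in> F"
        using t c by (auto simp: facet_cone_def mult_le_cancel_right1)
      then show "g (t *\<^sub>R x) * indicator ?C (t *\<^sub>R x) = ennreal (t ^ k) * (g x * indicator F x)"
        using t by (simp add: hom indicator_def)
    qed measurable
    also have "\<dots> = ennreal (t ^ k) * ?J"
      by (rule nn_integral_cmult) measurable
    also have "ennreal (t ^ (CARD('n) - 1)) * (ennreal (t ^ k) * ?J) = ennreal (t ^ m) * ?J"
      using t(1) unfolding m_def power_add by (simp add: ennreal_mult mult.assoc)
    finally show ?thesis
      using True by (simp add: t_def)
  next
    case False
    have "(\<integral>\<^sup>+x. g x * indicator ?C x \<partial>hyperplane_measure n s) = (\<integral>\<^sup>+x. 0 \<partial>hyperplane_measure n s)"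
      by (rule nn_integral_hyperplane_measure_cong[OF n])
        (use False in \<open>auto simp: facet_cone_def indicator_def\<close>)
    then show ?thesis using False that by auto
  qed
  have "(\<integral>\<^sup>+x. g x * indicator ?C x \<partial>lborel)
      = (\<integral>\<^sup>+s. (\<integral>\<^sup>+x. g x * indicator ?C x \<partial>hyperplane_measure n s) \<partial>lborel)"
    by (rule nn_integral_lborel_slices[OF n]) measurable
  also have "\<dots> = (\<integral>\<^sup>+s. ennreal ((s / c) ^ m) * indicator {0..c} s * ?J \<partial>lborel)"
  proof (rule nn_integral_cong_AE)
    have "AE s in lborel. s \<noteq> (0::real)" by (rule AE_lborel_singleton)
    then show "AE s in lborel. (\<integral>\<^sup>+x. g x * indicator ?C x \<partial>hyperplane_measure n s)
        = ennreal ((s / c) ^ m) * indicator {0..c} s * ?J"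
      by eventually_elim (rule slice)
  qed
  also have "\<dots> = (\<integral>\<^sup>+s. ennreal ((s / c) ^ m) * indicator {0..c} s \<partial>lborel) * ?J"
    by (rule nn_integral_multc) measurable
  also have "(\<integral>\<^sup>+s. ennreal ((s / c) ^ m) * indicator {0..c} s \<partial>lborel)
      = ennreal (c / (real m + 1) * (c / c) ^ (m + 1) - c / (real m + 1) * (0 / c) ^ (m + 1))"
  proof (rule nn_integral_FTC_Icc)
    show "((\<lambda>s. c / (real m + 1) * (s / c) ^ (m + 1)) has_real_derivative (s / c) ^ m) (at s)" for s
    proof (rule DERIV_cong)
      show "((\<lambda>s. c / (real m + 1) * (s / c) ^ (m + 1)) has_real_derivative
          c / (real m + 1) * (real (m + 1) * (s / c) ^ m * (1 / c))) (at s)"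
        using c by (auto intro!: derivative_eq_intros simp del: power_Suc)
      have "real m + 1 \<noteq> 0" by linarith
      then show "c / (real m + 1) * (real (m + 1) * (s / c) ^ m * (1 / c)) = (s / c) ^ m"
        using c by (simp add: add.commute)
    qed
  qed (use c in auto)
  also have "\<dots> = ennreal (c / real (CARD('n) + k))"
    using c m by simp
  finally show ?thesis .
qed

section \<open>Outward normals of polytopes\<close>

text \<open>All halfspaces that describe the convex pieces are collected in one finite set \<open>A\<close>, so that
  membership in \<open>K\<close> depends only on which of the inequalities in \<open>A\<close> hold.\<close>
lemma solid_polytope_halfspaces:
  fixes K :: "(real ^ 'n) set"
  assumes "solid_polytope K"
  obtains \<P> A where "finite \<P>" "\<P> \<noteq> {}" "K = \<Union>\<P>" "\<And>P. P \<in> \<P> \<Longrightarrow> polytope P \<and> interior P \<noteq> {}"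
    "finite A" "\<And>a b. (a, b) \<in> A \<Longrightarrow> a \<noteq> 0"
    "\<And>P. P \<in> \<P> \<Longrightarrow> \<exists>A'\<subseteq>A. P = {x. \<forall>(a, b)\<in>A'. a \<bullet> x \<le> b}"
proof -
  obtain \<P> where P: "finite \<P>" "\<P> \<noteq> {}" "K = \<Union>\<P>" "\<And>P. P \<in> \<P> \<Longrightarrow> polytope P \<and> interior P \<noteq> {}"
    using assms unfolding solid_polytope_def by blast
  have "\<exists>A. finite A \<and> (\<forall>(a, b)\<in>A. a \<noteq> 0) \<and> P = {x. \<forall>(a, b)\<in>A. a \<bullet> x \<le> b}" if "P \<in> \<P>" for P
  proof -
    have "polyhedron P" using P(4)[OF that] by (simp add: polytope_imp_polyhedron)
    then obtain F where F: "finite F" "P = \<Inter>F"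
      and "\<forall>h\<in>F. \<exists>a b. a \<noteq> 0 \<and> h = {x. a \<bullet> x \<le> b}"
      unfolding polyhedron_def by blast
    then obtain a where "\<forall>h\<in>F. \<exists>b. a h \<noteq> 0 \<and> h = {x. a h \<bullet> x \<le> b}"
      using bchoice[of F "\<lambda>h a. \<exists>b. a \<noteq> 0 \<and> h = {x. a \<bullet> x \<le> b}"] by blast
    then obtain b where ab: "\<forall>h\<in>F. a h \<noteq> 0 \<and> h = {x. a h \<bullet> x \<le> b h}"
      using bchoice[of F "\<lambda>h b. a h \<noteq> 0 \<and> h = {x. a h \<bullet> x \<le> b}"] by blast
    have mem: "x \<in> h \<longleftrightarrow> a h \<bullet> x \<le> b h" if "h \<in> F" for h x
      using ab that by blast
    have "P = {x. \<forall>(a, b)\<in>(\<lambda>h. (a h, b h)) ` F. a \<bullet> x \<le> b}"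
      using F(2) mem by auto
    moreover have "\<forall>h\<in>F. a h \<noteq> 0" using ab by blast
    ultimately show ?thesis using F(1)
      by (intro exI[of _ "(\<lambda>h. (a h, b h)) ` F"]) auto
  qed
  then have "\<forall>P\<in>\<P>. \<exists>A. finite A \<and> (\<forall>(a, b)\<in>A. a \<noteq> 0) \<and> P = {x. \<forall>(a, b)\<in>A. a \<bullet> x \<le> b}"
    by blast
  from bchoice[OF this] obtain AA where "\<forall>P\<in>\<P>. finite (AA P) \<and> (\<forall>(a, b)\<in>AA P. a \<noteq> 0)
      \<and> P = {x. \<forall>(a, b)\<in>AA P. a \<bullet> x \<le> b}" ..
  note AA = bspec[OF this]
  let ?A = "\<Union>(AA ` \<P>)"
  show ?thesis
  proof (rule that)
    show "finite ?A"
      by (rule finite_UN_I[OF P(1)]) (rule AA[THEN conjunct1])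
    show "a \<noteq> 0" if ab: "(a, b) \<in> ?A" for a b
    proof -
      obtain P where P: "P \<in> \<P>" "(a, b) \<in> AA P" using ab by (rule UN_E)
      show ?thesis using AA[OF P(1), THEN conjunct2, THEN conjunct1] P(2) by blast
    qed
    show "\<exists>A'\<subseteq>?A. P = {x. \<forall>(a, b)\<in>A'. a \<bullet> x \<le> b}" if P: "P \<in> \<P>" for P
      using AA[OF P, THEN conjunct2, THEN conjunct2] UN_upper[OF P] by (intro exI[of _ "AA P"] conjI)
    show "polytope P \<and> interior P \<noteq> {}" if "P \<in> \<P>" for P by (rule P(4)[OF that])
  qed (rule P(1-3))+
qed

lemma solid_polytope_compact:
  assumes "solid_polytope K"
  shows "compact K"
proof -
  obtain \<P> where "finite \<P>" "\<forall>P\<in>\<P>. polytope P" "K = \<Union>\<P>"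
    using assms unfolding solid_polytope_def by blast
  then show ?thesis by (simp add: compact_Union polytope_imp_compact)
qed

lemma outward_unit_normal_halfspace:
  fixes v :: "real ^ 'n"
  assumes v: "v \<bullet> x = 1" and e: "e > 0" and K: "\<And>y. y \<in> ball x e \<Longrightarrow> y \<in> K \<longleftrightarrow> s * (v \<bullet> y - 1) \<le> 0"
    and s: "\<bar>s\<bar> = 1"
  shows "outward_unit_normal K x ((s / norm v) *\<^sub>R v)"
proof -
  have nv: "norm v > 0" using v by auto
  have "((s / norm v) *\<^sub>R v) \<bullet> (y - x) \<le> 0 \<longleftrightarrow> s * (v \<bullet> y - 1) \<le> 0" for y
  proof -
    have "((s / norm v) *\<^sub>R v) \<bullet> (y - x) = (s * (v \<bullet> y - 1)) / norm v"
      using v by (simp add: inner_diff_right right_diff_distrib diff_divide_distrib)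
    then show ?thesis using nv by (simp only: divide_le_0_iff) simp
  qed
  then show ?thesis
    unfolding outward_unit_normal_def using nv s e K
    by (intro conjI exI[of _ e]) auto
qed

text \<open>Near a frontier point that lies on only one of the hyperplanes bounding the halfspaces,
  \<open>K\<close> is one side of that hyperplane: membership depends only on the side, \<open>K\<close> is closed, the point is not
  interior, and \<open>K\<close> is not contained in the hyperplane because all pieces are full-dimensional.

  The exceptional points are collected by vectors \<open>w\<close> such that \<open>w \<bullet> x = 0\<close>. If \<open>x\<close> satisfies
  \<open>a \<bullet> x = b\<close> and \<open>a' \<bullet> x = b'\<close>, then it is orthogonal to \<open>b' a - b a'\<close>, which vanishes only if the two
  hyperplanes coincide or both pass through the origin; in the latter case \<open>x\<close> is orthogonal to \<open>a\<close>. Thus the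
  whole cone with apex 0 over the exceptional points is contained in finitely many hyperplanes through
  the origin and is a null set.\<close>
lemma frontier_normals:
  fixes K :: "(real ^ 'n) set"
  assumes K: "solid_polytope K"
  obtains W normals where "finite W" "0 \<notin> W" "finite normals"
    "\<And>x. x \<in> frontier K \<Longrightarrow> \<forall>w\<in>W. w \<bullet> x \<noteq> 0 \<Longrightarrow> \<exists>n\<in>normals. outward_unit_normal K x n \<and> n \<bullet> x \<noteq> 0"
proof -
  obtain \<P> A where P: "finite \<P>" "\<P> \<noteq> {}" "K = \<Union>\<P>" "\<And>P. P \<in> \<P> \<Longrightarrow> polytope P \<and> interior P \<noteq> {}"
    and A: "finite A" "\<And>a b. (a, b) \<in> A \<Longrightarrow> a \<noteq> 0"
    "\<And>P. P \<in> \<P> \<Longrightarrow> \<exists>A'\<subseteq>A. P = {x. \<forall>(a, b)\<in>A'. a \<bullet> x \<le> b}"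
    by (rule solid_polytope_halfspaces[OF K]) blast
  define W where "W = fst ` {p \<in> A. snd p = 0}
    \<union> ((\<lambda>(p, q). snd q *\<^sub>R fst p - snd p *\<^sub>R fst q) ` (A \<times> A) - {0})"
  define normals where "normals = (\<lambda>(s, p). s *\<^sub>R (fst p /\<^sub>R norm (fst p))) ` ({-1, 1} \<times> A)"
  have closed: "closed K" using solid_polytope_compact[OF K] by (rule compact_imp_closed)
  show ?thesis
  proof (rule that[of W normals])
    show "finite W" "finite normals" using A(1) by (auto simp: W_def normals_def)
    show "0 \<notin> W" using A(2) by (auto simp: W_def)
    fix x assume x: "x \<in> frontier K" and xW: "\<forall>w\<in>W. w \<bullet> x \<noteq> 0"
    have xK: "x \<in> K" and xint: "x \<notin> interior K"
      using x closed by (auto simp: frontier_def)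
    define I where "I = {p \<in> A. fst p \<bullet> x = snd p}"
    have active: "b \<noteq> 0" if "(a, b) \<in> I" for a b
    proof
      assume "b = 0"
      with that have "a \<in> W" unfolding W_def I_def by force
      with xW that \<open>b = 0\<close> show False by (auto simp: I_def)
    qed
    have parallel: "b' *\<^sub>R a = b *\<^sub>R a'" if "(a, b) \<in> I" "(a', b') \<in> I" for a b a' b'
    proof (rule ccontr)
      assume "b' *\<^sub>R a \<noteq> b *\<^sub>R a'"
      then have "b' *\<^sub>R a - b *\<^sub>R a' \<in> W"
        using that unfolding W_def I_def by force
      with xW that show False by (auto simp: I_def inner_diff_left)
    qed
    have ev: "\<forall>\<^sub>F y in nhds x. a \<bullet> y \<le> b \<longleftrightarrow> a \<bullet> x \<le> b" if "(a, b) \<in> A - I" for a b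
    proof -
      have t: "((\<lambda>y. a \<bullet> y) \<longlongrightarrow> a \<bullet> x) (nhds x)" by (intro tendsto_intros) (simp add: filterlim_ident)
      have "a \<bullet> x \<noteq> b" using that by (auto simp: I_def)
      then consider "a \<bullet> x < b" | "a \<bullet> x > b" by linarith
      then show ?thesis
      proof cases
        case 1
        then show ?thesis using order_tendstoD(2)[OF t 1] by (auto elim: eventually_mono)
      next
        case 2
        then show ?thesis using order_tendstoD(1)[OF t 2] by (auto elim: eventually_mono)
      qed
    qed
    have "\<forall>\<^sub>F y in nhds x. \<forall>p\<in>A - I. fst p \<bullet> y \<le> snd p \<longleftrightarrow> fst p \<bullet> x \<le> snd p"
      using A(1) ev by (intro eventually_ball_finite) auto
    then obtain e where e: "e > 0"
      and inact: "\<And>y a b. y \<in> ball x e \<Longrightarrow> (a, b) \<in> A - I \<Longrightarrow> a \<bullet> y \<le> b \<longleftrightarrow> a \<bullet> x \<le> b"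
      unfolding eventually_nhds_metric by (metis fst_conv snd_conv mem_ball dist_commute)
    have same: "y \<in> K \<longleftrightarrow> z \<in> K" if y: "y \<in> ball x e" and z: "z \<in> ball x e"
      and I: "\<And>a b. (a, b) \<in> I \<Longrightarrow> a \<bullet> y \<le> b \<longleftrightarrow> a \<bullet> z \<le> b" for y z
    proof -
      have "a \<bullet> y \<le> b \<longleftrightarrow> a \<bullet> z \<le> b" if "(a, b) \<in> A" for a b
        using inact[OF y, of a b] inact[OF z, of a b] I[of a b] that by blast
      then have "y \<in> P \<longleftrightarrow> z \<in> P" if "P \<in> \<P>" for P
        using A(3)[OF that] by blast
      then show ?thesis using P(3) by blast
    qed
    have "I \<noteq> {}"
    proof
      assume "I = {}"
      then have "ball x e \<subseteq> K" using same[of _ x] xK e by auto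
      then show False using xint e by (meson centre_in_ball interior_maximal open_ball subsetD)
    qed
    then obtain a b where ab: "(a, b) \<in> I" by auto
    then have b: "b \<noteq> 0" and aA: "(a, b) \<in> A" and ax: "a \<bullet> x = b" using active by (auto simp: I_def)
    \<comment> \<open>All constraints active at \<open>x\<close> have the boundary hyperplane \<open>v \<bullet> y = 1\<close>.\<close>
    define v where "v = a /\<^sub>R b"
    have v: "v \<bullet> x = 1" using b ax by (simp add: v_def)
    then have v0: "v \<noteq> 0" by auto
    have Iv: "a' = b' *\<^sub>R v" if "(a', b') \<in> I" for a' b'
    proof -
      have "a' = inverse b *\<^sub>R (b *\<^sub>R a')" using b by simp
      also have "\<dots> = b' *\<^sub>R v"
        unfolding parallel[OF ab that, symmetric] by (simp add: v_def mult.commute)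
      finally show ?thesis .
    qed
    have same_sgn: "y \<in> K \<longleftrightarrow> z \<in> K" if "y \<in> ball x e" "z \<in> ball x e" "sgn (v \<bullet> y - 1) = sgn (v \<bullet> z - 1)" for y z
    proof (rule same[OF that(1,2)])
      fix a' b' assume ab': "(a', b') \<in> I"
      have "a' \<bullet> u \<le> b' \<longleftrightarrow> sgn b' * sgn (v \<bullet> u - 1) \<le> 0" for u
      proof -
        have "a' \<bullet> u \<le> b' \<longleftrightarrow> b' * (v \<bullet> u - 1) \<le> 0"
          using Iv[OF ab'] by (simp add: algebra_simps)
        also have "\<dots> \<longleftrightarrow> sgn (b' * (v \<bullet> u - 1)) \<le> 0" by (simp only: sgn_le_0_iff)
        finally show ?thesis by (simp add: sgn_mult)
      qed
      then show "a' \<bullet> y \<le> b' \<longleftrightarrow> a' \<bullet> z \<le> b'" using that(3) by simp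
    qed
    have on: "y \<in> K" if "y \<in> ball x e" "v \<bullet> y = 1" for y
      using same_sgn[OF that(1), of x] that v xK e by simp
    \<comment> \<open>One side of the hyperplane near \<open>x\<close> contains \<open>z\<close> and lies in \<open>K\<close>, the other contains \<open>z'\<close> and is
      disjoint from \<open>K\<close>.\<close>
    obtain z where z: "z \<in> ball x e" "z \<in> K" "v \<bullet> z \<noteq> 1"
    proof -
      obtain P where PP: "P \<in> \<P>" "x \<in> P" using xK P(3) by auto
      have "convex P" "closed P" "interior P \<noteq> {}"
        using P(4)[OF PP(1)] by (auto simp: polytope_imp_convex polytope_imp_closed)
      then have "x \<in> closure (interior P)"
        using PP(2) by (simp add: convex_closure_interior)
      then have "interior P \<inter> ball x e \<noteq> {}"
        using e by (meson centre_in_ball disjoint_iff open_Int_closure_eq_empty open_ball inf_commute)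
      then have "\<not> negligible (interior P \<inter> ball x e)"
        by (intro open_not_negligible) auto
      moreover have "negligible {y. v \<bullet> y = 1}" using v0 by (simp add: negligible_hyperplane)
      ultimately have "\<not> interior P \<inter> ball x e \<subseteq> {y. v \<bullet> y = 1}"
        using negligible_subset by blast
      then obtain z where "z \<in> interior P" "z \<in> ball x e" "v \<bullet> z \<noteq> 1" by blast
      with that show ?thesis using P(3) PP(1) interior_subset by blast
    qed
    obtain z' where z': "z' \<in> ball x e" "z' \<notin> K"
      using xint e by (metis interiorI open_ball centre_in_ball subsetI)
    have v1: "v \<bullet> z' \<noteq> 1" using on z' by auto
    have diff: "sgn (v \<bullet> z' - 1) \<noteq> sgn (v \<bullet> z - 1)" using same_sgn[OF z'(1) z(1)] z' z by auto
    define s where "s = - sgn (v \<bullet> z - 1)"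
    have s: "\<bar>s\<bar> = 1" using z(3) by (simp add: s_def abs_sgn_eq)
    have "y \<in> K \<longleftrightarrow> s * (v \<bullet> y - 1) \<le> 0" if "y \<in> ball x e" for y
    proof (cases "v \<bullet> y = 1")
      case True
      then show ?thesis using on that by simp
    next
      case False
      show ?thesis
      proof (cases "sgn (v \<bullet> y - 1) = sgn (v \<bullet> z - 1)")
        case True
        then show ?thesis using same_sgn[OF that z(1)] z
          by (simp add: s_def sgn_if split: if_splits)
      next
        case ne: False
        then have "sgn (v \<bullet> y - 1) = sgn (v \<bullet> z' - 1)"
          using False diff v1 z(3) by (simp add: sgn_if split: if_splits)
        then show ?thesis using same_sgn[OF that z'(1)] z' ne False z(3)
          by (simp add: s_def sgn_if split: if_splits)
      qed
    qed
    then have "outward_unit_normal K x ((s / norm v) *\<^sub>R v)"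
      by (rule outward_unit_normal_halfspace[OF v e _ s])
    moreover have "(s / norm v) *\<^sub>R v \<in> normals"
    proof -
      have "(s / norm v) *\<^sub>R v = (s * sgn b) *\<^sub>R (a /\<^sub>R norm a)"
        using b v0 by (simp add: v_def sgn_if field_simps)
      moreover have "s * sgn b \<in> {-1, 1}"
        using s b by (auto simp: sgn_if)
      ultimately show ?thesis
        unfolding normals_def using aA by (auto intro!: image_eqI[of _ _ "(s * sgn b, (a, b))"])
    qed
    moreover have "((s / norm v) *\<^sub>R v) \<bullet> x \<noteq> 0"
      using v v0 s by auto
    ultimately show "\<exists>n\<in>normals. outward_unit_normal K x n \<and> n \<bullet> x \<noteq> 0" by blast
  qed
qed

lemma solid_polytope_interior:
  assumes "solid_polytope K" shows "interior K \<noteq> {}"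
proof -
  obtain \<P> where "\<P> \<noteq> {}" "\<forall>P\<in>\<P>. interior P \<noteq> {}" "K = \<Union>\<P>"
    using assms unfolding solid_polytope_def by blast
  moreover from this obtain P where "P \<in> \<P>" by blast
  ultimately show ?thesis using interior_mono[of P K] by blast
qed

lemma measure_solid_polytope_pos:
  assumes K: "solid_polytope K"
  shows "measure lborel K > 0"
proof -
  have "\<not> negligible K"
    using solid_polytope_interior[OF K] open_not_negligible[of "interior K"] negligible_subset[OF _ interior_subset]
    by auto
  moreover have "K \<in> lmeasurable"
    using solid_polytope_compact[OF K] by (rule lmeasurable_compact)
  ultimately have "measure lebesgue K \<noteq> 0"
    by (simp add: negligible_iff_measure0)
  moreover have "K \<in> sets borel"
    using solid_polytope_compact[OF K] by (simp add: compact_imp_closed)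
  ultimately show ?thesis
    by (simp add: zero_less_measure_iff measure_completion)
qed

text \<open>Both normals define the same halfspace near \<open>x\<close>. Testing with the direction \<open>n - n'\<close>, which does not
  leave the halfspace of \<open>n'\<close>, forces \<open>n \<bullet> n' \<ge> 1\<close>.\<close>
lemma outward_unit_normal_unique:
  assumes n: "outward_unit_normal K x n" and n': "outward_unit_normal K x n'"
  shows "n = n'"
proof -
  obtain e where e: "e > 0" "\<And>y. y \<in> ball x e \<Longrightarrow> y \<in> K \<longleftrightarrow> n \<bullet> (y - x) \<le> 0"
    using n unfolding outward_unit_normal_def by blast
  obtain e' where e': "e' > 0" "\<And>y. y \<in> ball x e' \<Longrightarrow> y \<in> K \<longleftrightarrow> n' \<bullet> (y - x) \<le> 0"
    using n' unfolding outward_unit_normal_def by blast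
  define z where "z = n - n'"
  obtain t where t: "t > 0" "t * norm z < min e e'"
  proof
    show "min e e' / (norm z + 1) > 0" using e(1) e'(1) by (intro divide_pos_pos) (auto intro: add_nonneg_pos)
    have "min e e' / (norm z + 1) * norm z = min e e' * (norm z / (norm z + 1))" by simp
    also have "\<dots> < min e e' * 1"
      using e(1) e'(1) by (intro mult_strict_left_mono) (auto simp: divide_less_eq_1 add_nonneg_pos)
    finally show "min e e' / (norm z + 1) * norm z < min e e'" by simp
  qed
  have "x + t *\<^sub>R z \<in> ball x e" "x + t *\<^sub>R z \<in> ball x e'"
    using t by (auto simp: dist_norm)
  then have "n \<bullet> (t *\<^sub>R z) \<le> 0 \<longleftrightarrow> n' \<bullet> (t *\<^sub>R z) \<le> 0"
    using e(2) e'(2) by (metis add_diff_cancel_left')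
  then have iff: "n \<bullet> z \<le> 0 \<longleftrightarrow> n' \<bullet> z \<le> 0" using t(1) by (simp add: mult_le_0_iff)
  have unit: "n \<bullet> n = 1" "n' \<bullet> n' = 1"
    using n n' by (auto simp: outward_unit_normal_def norm_eq_1)
  have "n \<bullet> n' \<le> 1"
    using norm_cauchy_schwarz[of n n'] n n' by (simp add: outward_unit_normal_def)
  then have "n' \<bullet> z \<le> 0" by (simp add: z_def inner_diff_right unit inner_commute)
  then have "n \<bullet> z \<le> 0" using iff by simp
  then have "(norm (n - n'))\<^sup>2 \<le> 0"
    using unit by (simp add: z_def power2_norm_eq_inner inner_diff_left inner_diff_right inner_commute)
  then show ?thesis by simp
qed

lemma outward_unit_normal_leaves:
  assumes n: "outward_unit_normal K x n" and d: "n \<bullet> d > 0" and e: "e > 0"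
  obtains t where "0 < t" "t < e" "x + t *\<^sub>R d \<notin> K"
proof -
  obtain r where r: "r > 0" "\<And>y. y \<in> ball x r \<Longrightarrow> y \<in> K \<longleftrightarrow> n \<bullet> (y - x) \<le> 0"
    using n unfolding outward_unit_normal_def by blast
  have nd: "norm d > 0" using d by auto
  define t where "t = min (e / 2) (r / (2 * norm d))"
  have t: "0 < t" "t < e" using e r(1) nd by (auto simp: t_def)
  have "t * norm d \<le> r / (2 * norm d) * norm d" by (intro mult_right_mono) (auto simp: t_def)
  also have "\<dots> < r" using r(1) nd by simp
  finally have "x + t *\<^sub>R d \<in> ball x r" using t by (simp add: dist_norm)
  then have "x + t *\<^sub>R d \<notin> K" using r(2) t d by (simp add: not_le)
  with t that show ?thesis by blast
qed

lemma outward_unit_normal_frontier: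
  assumes "outward_unit_normal K x n"
  shows "x \<in> K" "x \<in> frontier K"
proof -
  obtain r where r: "r > 0" "\<And>y. y \<in> ball x r \<Longrightarrow> y \<in> K \<longleftrightarrow> n \<bullet> (y - x) \<le> 0"
    using assms unfolding outward_unit_normal_def by blast
  show x: "x \<in> K" using r(2)[of x] r(1) by simp
  have nn: "n \<bullet> n > 0" using assms by (auto simp: outward_unit_normal_def norm_eq_1)
  have "x \<notin> interior K"
  proof
    assume "x \<in> interior K"
    then obtain e where e: "e > 0" "ball x e \<subseteq> K" unfolding mem_interior by blast
    obtain t where "0 < t" "t < e" "x + t *\<^sub>R n \<notin> K"
      by (rule outward_unit_normal_leaves[OF assms nn e(1)])
    moreover from this have "x + t *\<^sub>R n \<in> ball x e"
      using assms by (simp add: dist_norm outward_unit_normal_def)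
    ultimately show False using e(2) by blast
  qed
  with x show "x \<in> frontier K" using closure_subset by (auto simp: frontier_def)
qed

lemma facet_points_eq:
  assumes "norm n = 1"
  shows "facet_points K n c = {x. n \<bullet> x = c} \<inter> interior {y. y \<in> K \<longleftrightarrow> n \<bullet> y \<le> c}"
  using assms unfolding facet_points_def outward_unit_normal_def
  by (auto simp: mem_interior subset_iff inner_diff_right Ball_def)

lemma borel_facet_points:
  assumes "norm n = 1"
  shows "facet_points K n c \<in> sets borel"
proof -
  have "closed {x. n \<bullet> x = c}" by (rule closed_hyperplane)
  then show ?thesis unfolding facet_points_eq[OF assms] by auto
qed

section \<open>Isometries and star centers\<close>

lemma isometry_orbit_eq: "isometry_orbit K x = (\<lambda>f. f x) ` isometries_of K"
  by (auto simp: isometry_orbit_def)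

lemma self_in_isometry_orbit: "x \<in> isometry_orbit K x"
proof -
  have "(\<lambda>x. x) \<in> isometries_of K" by (simp add: isometries_of_def)
  from imageI[OF this, of "\<lambda>f. f x"] show ?thesis by (simp add: isometry_orbit_eq)
qed

text \<open>The orbit of a common fixed point is a singleton.\<close>
lemma common_fixed_point_eq_0:
  fixes K :: "(real ^ 'n) set"
  assumes orb: "{x. is_singleton (isometry_orbit K x)} = {0}"
    and fixed: "\<And>f. f \<in> isometries_of K \<Longrightarrow> f p = p"
  shows "p = 0"
proof -
  have "isometry_orbit K p = {p}"
    using self_in_isometry_orbit[of p K] fixed by (auto simp: isometry_orbit_eq)
  then have "p \<in> {x. is_singleton (isometry_orbit K x)}" by simp
  with orb show ?thesis by auto
qed

text \<open>The origin has a singleton orbit, so the isometries fix it and are linear.\<close>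
lemma isometries_of_orthogonal:
  fixes K :: "(real ^ 'n) set"
  assumes orb: "{x. is_singleton (isometry_orbit K x)} = {0}"
    and f: "f \<in> isometries_of K"
  shows "orthogonal_transformation f"
proof -
  have "is_singleton (isometry_orbit K 0)" using orb by auto
  moreover have "f 0 \<in> isometry_orbit K 0" "0 \<in> isometry_orbit K 0"
    using f self_in_isometry_orbit by (auto simp: isometry_orbit_eq)
  ultimately have "f 0 = 0" by (auto simp: is_singleton_def)
  then show ?thesis
    using f by (auto simp: orthogonal_transformation_isometry isometries_of_def)
qed

text \<open>Also called the kernel of \<open>K\<close>.\<close>
definition star_centers :: "'a :: real_vector set \<Rightarrow> 'a set" where
  "star_centers K = {a \<in> K. \<forall>x\<in>K. closed_segment a x \<subseteq> K}"

text \<open>A point of the triangle \<open>a b x\<close> lies on a segment from \<open>a\<close> to a point of the segment from \<open>b\<close> to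
  \<open>x\<close>, which is contained in \<open>K\<close>.\<close>
lemma convex_star_centers: "convex (star_centers K)"
  unfolding convex_contains_segment
proof (intro ballI subsetI)
  fix a b p assume a: "a \<in> star_centers K" and b: "b \<in> star_centers K" and p: "p \<in> closed_segment a b"
  have "closed_segment p x \<subseteq> K" if "x \<in> K" for x
  proof -
    have "closed_segment p x \<subseteq> convex hull {a, b, x}"
      using p by (intro closed_segment_subset_convex_hull)
        (auto simp: segment_convex_hull intro: hull_inc hull_mono[THEN subsetD, rotated])
    also have "\<dots> \<subseteq> K"
    proof
      fix z assume "z \<in> convex hull {a, b, x}"
      then obtain y where "y \<in> convex hull {b, x}" "z \<in> closed_segment a y"
        unfolding convex_hull_insert_segments[of a "{b, x}"] by auto
      then show "z \<in> K"
        using a b that unfolding star_centers_def by (auto simp: segment_convex_hull[symmetric])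
    qed
    finally show ?thesis .
  qed
  moreover have "p \<in> K"
    using a b p unfolding star_centers_def by auto
  ultimately show "p \<in> star_centers K" by (simp add: star_centers_def)
qed

lemma closed_star_centers:
  fixes K :: "'a :: real_normed_vector set"
  assumes "closed K"
  shows "closed (star_centers K)"
proof -
  have "star_centers K = K \<inter> (\<Inter>x\<in>K. \<Inter>u\<in>{0..1}. (\<lambda>a. (1 - u) *\<^sub>R a + u *\<^sub>R x) -` K)"
    by (fastforce simp: star_centers_def closed_segment_def)
  moreover have "closed ((\<lambda>a. (1 - u) *\<^sub>R a + u *\<^sub>R x) -` K)" for u x
    using assms by (intro continuous_closed_vimage) (auto intro!: continuous_intros)
  ultimately show ?thesis using assms by (simp add: closed_Int closed_INT)
qed

text \<open>The star center closest to the origin is unique by convexity. An isometry of \<open>K\<close> maps it to a star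
  center of the same norm, so it is fixed by all isometries.\<close>
lemma star_center_at_origin:
  fixes K :: "(real ^ 'n) set"
  assumes K: "closed K" "starlike K"
    and orb: "{x. is_singleton (isometry_orbit K x)} = {0}"
  shows "0 \<in> star_centers K"
proof -
  let ?S = "star_centers K"
  have ne: "?S \<noteq> {}" using K(2) by (auto simp: starlike_def star_centers_def)
  define p where "p = closest_point ?S 0"
  note cl = closed_star_centers[OF K(1)]
  have p: "p \<in> ?S" "\<And>z. z \<in> ?S \<Longrightarrow> norm p \<le> norm z"
    unfolding p_def using closest_point_exists[OF cl ne, of 0] by auto
  have "f p = p" if f: "f \<in> isometries_of K" for f
  proof -
    have ot: "orthogonal_transformation f" by (rule isometries_of_orthogonal[OF orb f])
    have fK: "f ` K = K" using f by (simp add: isometries_of_def)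
    have "closed_segment (f p) x \<subseteq> K" if "x \<in> K" for x
    proof -
      have "x \<in> f ` K" unfolding fK by (rule that)
      then obtain y where y: "x = f y" "y \<in> K" ..
      have "closed_segment (f p) x = f ` closed_segment p y"
        using closed_segment_linear_image[OF orthogonal_transformation_linear[OF ot]] y(1) by auto
      also have "\<dots> \<subseteq> f ` K" using p(1) y(2) by (auto simp: star_centers_def)
      finally show ?thesis using fK by simp
    qed
    moreover have "f p \<in> K"
      using imageI[of p K f] p(1) unfolding fK star_centers_def by simp
    ultimately have "f p \<in> ?S" by (simp add: star_centers_def)
    moreover have "norm (f p) = norm p" by (rule orthogonal_transformation_norm[OF ot])
    ultimately show ?thesis
      unfolding p_def[symmetric]
      using closest_point_unique[OF convex_star_centers cl, of "f p" 0] p(2) by (simp add: p_def[symmetric])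
  qed
  then have "p = 0" by (rule common_fixed_point_eq_0[OF orb])
  with p(1) show ?thesis by simp
qed

section \<open>Decomposition into cones over the facets\<close>

lemma star_center_0_scale:
  assumes "0 \<in> star_centers K" "x \<in> K" "0 \<le> t" "t \<le> 1"
  shows "t *\<^sub>R x \<in> K"
proof -
  have "t *\<^sub>R x \<in> closed_segment 0 x" using assms(3,4) by (auto simp: in_segment)
  then show ?thesis using assms(1,2) unfolding star_centers_def by blast
qed

text \<open>\<open>K\<close> meets a ray from the origin in a segment, so a ray that crosses a facet outwards never returns.\<close>
lemma facet_leave:
  assumes K: "0 \<in> star_centers K" and n: "outward_unit_normal K x n" and pos: "n \<bullet> x > 0" and r: "r > 1"
  shows "r *\<^sub>R x \<notin> K"
proof
  assume rx: "r *\<^sub>R x \<in> K"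
  obtain t where t: "0 < t" "t < r - 1" "x + t *\<^sub>R x \<notin> K"
    using outward_unit_normal_leaves[OF n pos, of "r - 1"] r by auto
  have "((1 + t) / r) *\<^sub>R (r *\<^sub>R x) \<in> K"
    using t r by (intro star_center_0_scale[OF K rx]) auto
  moreover have "((1 + t) / r) *\<^sub>R (r *\<^sub>R x) = x + t *\<^sub>R x"
    using r by (simp add: scaleR_add_left)
  ultimately show False using t(3) by simp
qed

lemma outward_unit_normal_inner_nonneg:
  assumes K: "0 \<in> star_centers K" and n: "outward_unit_normal K x n"
  shows "n \<bullet> x \<ge> 0"
proof (rule ccontr)
  assume "\<not> n \<bullet> x \<ge> 0"
  then have "n \<bullet> (- x) > 0" by simp
  then obtain t where t: "0 < t" "t < 1" "x + t *\<^sub>R (- x) \<notin> K"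
    using outward_unit_normal_leaves[OF n, of "-x" 1] by auto
  have "(1 - t) *\<^sub>R x \<in> K"
    using t by (intro star_center_0_scale[OF K outward_unit_normal_frontier(1)[OF n]]) auto
  then show False using t(3) by (simp add: scaleR_diff_left)
qed

lemma ray_exit_point:
  fixes K :: "'a :: euclidean_space set"
  assumes K: "compact K" and x: "x \<in> K" "x \<noteq> 0"
  obtains T where "T \<ge> 1" "T *\<^sub>R x \<in> frontier K"
proof -
  define S where "S = (\<lambda>t. t *\<^sub>R x) -` K"
  have "closed S"
    unfolding S_def using compact_imp_closed[OF K]
    by (intro continuous_closed_vimage) (auto intro!: continuous_intros)
  obtain b where b: "\<And>y. y \<in> K \<Longrightarrow> norm y \<le> b"
    using compact_imp_bounded[OF K] unfolding bounded_iff by auto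
  have "\<bar>t\<bar> \<le> b / norm x" if "t \<in> S" for t
    using b[of "t *\<^sub>R x"] that x(2) by (simp add: S_def pos_le_divide_eq)
  then have "bounded S" unfolding bounded_iff by (auto intro!: exI[of _ "b / norm x"])
  with \<open>closed S\<close> have "compact S" by (simp add: compact_eq_bounded_closed)
  moreover have "1 \<in> S" using x by (simp add: S_def)
  ultimately obtain T where T: "T \<in> S" "\<And>t. t \<in> S \<Longrightarrow> t \<le> T"
    using compact_attains_sup[of S] by auto
  have "T *\<^sub>R x \<notin> interior K"
  proof
    assume "T *\<^sub>R x \<in> interior K"
    then obtain e where e: "e > 0" "ball (T *\<^sub>R x) e \<subseteq> K" unfolding mem_interior by blast
    define t where "t = T + e / (2 * norm x)"
    have "dist (T *\<^sub>R x) (t *\<^sub>R x) = norm ((T - t) *\<^sub>R x)"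
      by (simp add: dist_norm scaleR_diff_left)
    also have "\<dots> = e / 2" using e(1) x(2) by (simp add: t_def)
    finally have "t *\<^sub>R x \<in> K" using e by auto
    then have "t \<le> T" by (intro T(2)) (simp add: S_def)
    moreover have "t > T" using e(1) x(2) by (simp add: t_def)
    ultimately show False by simp
  qed
  moreover have "T *\<^sub>R x \<in> closure K" using T(1) closure_subset by (auto simp: S_def)
  ultimately show ?thesis
    using that[of T] T(2)[OF \<open>1 \<in> S\<close>] by (simp add: frontier_def)
qed

text \<open>Outside the null set \<open>N\<close> given by \<open>frontier_normals\<close>, which is closed under positive scaling, the ray
  from the origin through a point of \<open>K\<close> exits \<open>K\<close> at a point with a normal, so the point belongs to the
  cone over a facet. It belongs to no other cone because the exit point and its normal are unique. By
  star-convexity, all cones are contained in \<open>K\<close>. Since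
  \<open>K\<close> is not a null set, such an exit point exists, and there \<open>c = n \<bullet> x\<close> is nonnegative by
  star-convexity and nonzero by the choice of \<open>N\<close>. Every facet has a point outside \<open>N\<close>, as the
  open cone spanned by it is not a null set; hence its normal is one of the finitely many from
  \<open>frontier_normals\<close>.\<close>
lemma star_regular_cone_decomposition:
  fixes K :: "(real ^ 'n) set"
  assumes solid: "solid_polytope K" and star: "0 \<in> star_centers K"
    and dist: "\<forall>x n. outward_unit_normal K x n \<longrightarrow> n \<bullet> x = c"
  shows "c > 0"
    and "finite (facet_planes K)"
    and "AE x in lborel. indicator K x
      = (\<Sum>(n, c)\<in>facet_planes K. indicator (facet_cone n c (facet_points K n c)) x :: ennreal)"
proof -
  have c: "n \<bullet> x = c" if "outward_unit_normal K x n" for x n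
    using dist that by blast
  obtain W normals where W: "finite W" "0 \<notin> W" "finite normals"
    "\<And>x. x \<in> frontier K \<Longrightarrow> \<forall>w\<in>W. w \<bullet> x \<noteq> 0 \<Longrightarrow> \<exists>n\<in>normals. outward_unit_normal K x n \<and> n \<bullet> x \<noteq> 0"
    using frontier_normals[OF solid] by metis
  define N where "N = insert 0 (\<Union>w\<in>W. {x. w \<bullet> x = 0})"
  have "negligible {x. w \<bullet> x = 0}" if "w \<in> W" for w
    using that W(2) by (intro negligible_hyperplane) auto
  then have N: "negligible N"
    unfolding N_def using W(1) by (auto intro!: negligible_Union)
  have N_scale: "t *\<^sub>R x \<in> N \<longleftrightarrow> x \<in> N" if "t > 0" for t x
    using that by (auto simp: N_def)
  have exit: "\<exists>T n. T \<ge> 1 \<and> n \<in> normals \<and> outward_unit_normal K (T *\<^sub>R x) n \<and> c > 0" if "x \<in> K" "x \<notin> N" for x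
  proof -
    have "x \<noteq> 0" using that by (auto simp: N_def)
    with that obtain T where T: "T \<ge> 1" "T *\<^sub>R x \<in> frontier K"
      using ray_exit_point[OF solid_polytope_compact[OF solid]] by metis
    moreover have "T *\<^sub>R x \<notin> N" using T(1) that(2) by (simp add: N_scale)
    ultimately obtain n where n: "n \<in> normals" "outward_unit_normal K (T *\<^sub>R x) n" "n \<bullet> (T *\<^sub>R x) \<noteq> 0"
      using W(4)[of "T *\<^sub>R x"] by (auto simp: N_def)
    then have "c > 0"
      using outward_unit_normal_inner_nonneg[OF star n(2)] n(3) unfolding c[OF n(2)] by linarith
    with T n show ?thesis by blast
  qed
  have "\<not> interior K \<subseteq> N"
    using negligible_subset[OF N] open_not_negligible[of "interior K"] solid_polytope_interior[OF solid]
    by auto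
  then obtain x0 where "x0 \<in> K" "x0 \<notin> N" using interior_subset by blast
  from exit[OF this] show c_pos: "c > 0" by blast
  have plane: "\<exists>n. p = (n, c)" if "p \<in> facet_planes K" for p
    using c that by (fastforce simp: facet_planes_def)
  have "n \<in> normals" if y: "outward_unit_normal K y n" for y n
  proof -
    have n: "norm n = 1" using y by (simp add: outward_unit_normal_def)
    let ?I = "interior {y. y \<in> K \<longleftrightarrow> n \<bullet> y \<le> c}"
    let ?G = "{z. 0 < n \<bullet> z} \<inter> (\<lambda>z. (c / (n \<bullet> z)) *\<^sub>R z) -` ?I"
    have "y \<in> facet_points K n c" using y c[OF y] by (simp add: facet_points_def)
    then have "y \<in> ?G" using c_pos unfolding facet_points_eq[OF n] by auto
    moreover have "open ?G"
      by (rule continuous_open_preimage) (auto intro!: continuous_intros open_halfspace_gt)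
    ultimately have "\<not> negligible ?G" using open_not_negligible[of ?G] by blast
    then obtain z where z: "z \<in> ?G" "z \<notin> N" using negligible_subset[OF N, of ?G] by blast
    let ?y = "(c / (n \<bullet> z)) *\<^sub>R z"
    have "?y \<in> facet_points K n c"
      using z(1) unfolding facet_points_eq[OF n] by auto
    then have y': "outward_unit_normal K ?y n" by (simp add: facet_points_def)
    have "?y \<notin> N" using z c_pos by (simp add: N_scale)
    then obtain n' where "n' \<in> normals" "outward_unit_normal K ?y n'"
      using W(4)[OF outward_unit_normal_frontier(2)[OF y']] by (auto simp: N_def)
    with outward_unit_normal_unique[OF y'] show ?thesis by auto
  qed
  then have "facet_planes K \<subseteq> normals \<times> {c}"
    using c by (auto simp: facet_planes_def)
  then show fin: "finite (facet_planes K)"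
    using W(3) by (auto intro: finite_subset)
  let ?C = "\<lambda>(n, c). facet_cone n c (facet_points K n c)"
  have "indicator K x = (\<Sum>p\<in>facet_planes K. indicator (?C p) x :: ennreal)" if xN: "x \<notin> N" for x
  proof (cases "x \<in> K")
    case True
    obtain T n where T: "T \<ge> 1" and n: "outward_unit_normal K (T *\<^sub>R x) n"
      using exit[OF True xN] by blast
    have Tc: "T * (n \<bullet> x) = c" using c[OF n] by simp
    then have nx: "n \<bullet> x = c / T" using T by (simp add: field_simps)
    have mem: "(n, c) \<in> facet_planes K"
      using n c[OF n] unfolding facet_planes_def by force
    have "x \<in> ?C (n, c)"
      using T n c[OF n] c_pos by (simp add: facet_cone_def facet_points_def nx divide_le_eq)
    moreover have "p = (n, c)" if p: "p \<in> facet_planes K" "x \<in> ?C p" for p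
    proof -
      obtain n' where p': "p = (n', c)" using plane[OF p(1)] by blast
      define s where "s = c / (n' \<bullet> x)"
      have n': "outward_unit_normal K (s *\<^sub>R x) n'" and pos: "n' \<bullet> x > 0"
        using p(2) by (auto simp: p' facet_cone_def facet_points_def s_def)
      have s: "s > 0" using pos c_pos by (simp add: s_def)
      have "\<not> s > T"
      proof
        assume "s > T"
        then have "(s / T) *\<^sub>R (T *\<^sub>R x) \<notin> K"
          using T c_pos by (intro facet_leave[OF star n]) (simp_all only: c[OF n], simp)
        then show False using T outward_unit_normal_frontier(1)[OF n'] by simp
      qed
      moreover have "\<not> T > s"
      proof
        assume "T > s"
        then have "(T / s) *\<^sub>R (s *\<^sub>R x) \<notin> K"
          using s c_pos by (intro facet_leave[OF star n']) (simp_all only: c[OF n'], simp)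
        then show False using s outward_unit_normal_frontier(1)[OF n] by simp
      qed
      ultimately have "s = T" by simp
      with n n' outward_unit_normal_unique[of K "T *\<^sub>R x" n' n] show ?thesis by (simp add: p')
    qed
    ultimately have "x \<in> ?C p \<longleftrightarrow> p = (n, c)" if "p \<in> facet_planes K" for p
      using that by blast
    then have "(\<Sum>p\<in>facet_planes K. indicator (?C p) x :: ennreal)
        = (\<Sum>p\<in>facet_planes K. if p = (n, c) then 1 else 0)"
      unfolding indicator_def by (intro sum.cong refl) (simp only: of_bool_def)
    also have "\<dots> = 1" using fin mem by simp
    finally show ?thesis using True by simp
  next
    case False
    have "x \<notin> ?C p" if p: "p \<in> facet_planes K" for p
    proof
      assume x: "x \<in> ?C p"
      obtain n where p': "p = (n, c)" using plane[OF p] by blast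
      let ?y = "(c / (n \<bullet> x)) *\<^sub>R x"
      have n: "outward_unit_normal K ?y n" and pos: "n \<bullet> x > 0" "n \<bullet> x \<le> c"
        using x by (auto simp: p' facet_cone_def facet_points_def)
      have "(n \<bullet> x / c) *\<^sub>R ?y \<in> K"
        using pos c_pos by (intro star_center_0_scale[OF star outward_unit_normal_frontier(1)[OF n]]) auto
      then show False using False pos c_pos by simp
    qed
    then show ?thesis using False by (simp add: sum.neutral)
  qed
  moreover have "AE x in lborel. x \<notin> N"
  proof -
    have "N \<in> null_sets lebesgue" using N by (simp add: negligible_iff_null_sets)
    then have "AE x in lebesgue. x \<notin> N" by (rule AE_not_in)
    then show ?thesis by (simp add: AE_completion_iff)
  qed
  ultimately show "AE x in lborel. indicator K x
      = (\<Sum>(n, c)\<in>facet_planes K. indicator (facet_cone n c (facet_points K n c)) x :: ennreal)"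
    by (auto simp: case_prod_unfold)
qed

section \<open>Integrals of homogeneous functions\<close>

lemma nn_integral_star_regular_homogeneous:
  fixes K :: "(real ^ 'n) set" and g :: "real ^ 'n \<Rightarrow> ennreal"
  assumes solid: "solid_polytope K" and star: "0 \<in> star_centers K"
    and c: "\<forall>x n. outward_unit_normal K x n \<longrightarrow> n \<bullet> x = c"
    and g[measurable]: "g \<in> borel_measurable borel"
    and hom: "\<And>t x. t > 0 \<Longrightarrow> g (t *\<^sub>R x) = ennreal (t ^ k) * g x"
  shows "(\<integral>\<^sup>+x. g x * indicator K x \<partial>lborel) = ennreal (c / real (CARD('n) + k)) *
    (\<Sum>(n, c)\<in>facet_planes K. \<integral>\<^sup>+x. g x * indicator (facet_points K n c) x \<partial>hyperplane_measure n c)"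
proof -
  note dec = star_regular_cone_decomposition[OF solid star c]
  have plane: "norm n = 1 \<and> c' = c" if "(n, c') \<in> facet_planes K" for n c'
    using c that by (fastforce simp: facet_planes_def outward_unit_normal_def)
  have [measurable]: "facet_points K n c' \<in> sets borel" if "(n, c') \<in> facet_planes K" for n c'
    using plane[OF that] by (intro borel_facet_points) auto
  have "(\<integral>\<^sup>+x. g x * indicator K x \<partial>lborel)
      = (\<integral>\<^sup>+x. (\<Sum>(n, c)\<in>facet_planes K. g x * indicator (facet_cone n c (facet_points K n c)) x) \<partial>lborel)"
    by (rule nn_integral_cong_AE, use dec(3) in eventually_elim)
      (simp add: sum_distrib_left case_prod_unfold)
  also have "\<dots> = (\<Sum>(n, c)\<in>facet_planes K. \<integral>\<^sup>+x. g x * indicator (facet_cone n c (facet_points K n c)) x \<partial>lborel)"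
    unfolding case_prod_unfold by (rule nn_integral_sum) auto
  also have "\<dots> = (\<Sum>(n, c')\<in>facet_planes K. ennreal (c / real (CARD('n) + k)) *
      (\<integral>\<^sup>+x. g x * indicator (facet_points K n c') x \<partial>hyperplane_measure n c'))"
  proof (rule sum.cong[OF refl], clarify)
    fix n c' assume p: "(n, c') \<in> facet_planes K"
    show "(\<integral>\<^sup>+x. g x * indicator (facet_cone n c' (facet_points K n c')) x \<partial>lborel) =
      ennreal (c / real (CARD('n) + k)) * (\<integral>\<^sup>+x. g x * indicator (facet_points K n c') x \<partial>hyperplane_measure n c')"
      using plane[OF p] p dec(1) nn_integral_facet_cone[of n c' g k "facet_points K n c'"] hom by simp
  qed
  finally show ?thesis by (simp add: sum_distrib_left case_prod_unfold)
qed

lemma set_lebesgue_integral_eq_nn_integral: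
  fixes U :: "'a \<Rightarrow> real"
  assumes "set_integrable M A U"
  shows "(LINT x:A|M. U x) = enn2real (\<integral>\<^sup>+x. ennreal (U x) * indicator A x \<partial>M)
    - enn2real (\<integral>\<^sup>+x. ennreal (- U x) * indicator A x \<partial>M)"
proof -
  have "ennreal (indicator A x * U x) = ennreal (U x) * indicator A x"
    "ennreal (- (indicator A x * U x)) = ennreal (- U x) * indicator A x" for x
    by (auto simp: indicator_def)
  then show ?thesis
    using real_lebesgue_integral_def[of M "\<lambda>x. indicator A x * U x"] assms
    by (simp add: set_integrable_def set_lebesgue_integral_def)
qed

lemma set_integrableI_nn_integral_finite:
  fixes U :: "'a \<Rightarrow> real"
  assumes [measurable]: "U \<in> borel_measurable M" "A \<in> sets M"
    and fin: "(\<integral>\<^sup>+x. ennreal \<bar>U x\<bar> * indicator A x \<partial>M) < \<infinity>"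
  shows "set_integrable M A U"
  unfolding set_integrable_def
proof (rule integrableI_bounded)
  have "ennreal (norm (indicator A x *\<^sub>R U x)) = ennreal \<bar>U x\<bar> * indicator A x" for x
    by (auto simp: indicator_def)
  then show "(\<integral>\<^sup>+x. ennreal (norm (indicator A x *\<^sub>R U x)) \<partial>M) < \<infinity>" using fin by simp
qed measurable

text \<open>The identity for real-valued \<open>U\<close> follows by splitting into positive and negative parts, which are
  again positively homogeneous. Applied to the absolute value of \<open>U\<close>, it bounds the facet integrals
  by the integral over the compact cell.\<close>
lemma star_regular_homogeneous_integral:
  fixes K :: "(real ^ 'n) set" and U :: "real ^ 'n \<Rightarrow> real"
  assumes solid: "solid_polytope K" and star: "0 \<in> star_centers K"
    and c: "\<forall>x n. outward_unit_normal K x n \<longrightarrow> n \<bullet> x = c"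
    and U: "continuous_on UNIV U"
    and hom: "\<And>t x. t > 0 \<Longrightarrow> U (t *\<^sub>R x) = t ^ k * U x"
  shows "set_integrable lborel K U"
    and "\<And>n c. (n, c) \<in> facet_planes K \<Longrightarrow> set_integrable (hyperplane_measure n c) (facet_points K n c) U"
    and "(LINT x:K|lborel. U x) = c / real (CARD('n) + k) * boundary_integral K U"
proof -
  note dec = star_regular_cone_decomposition[OF solid star c]
  define q where "q = c / real (CARD('n) + k)"
  have q: "q > 0" using dec(1) by (auto simp: q_def intro!: divide_pos_pos add_pos_nonneg)
  have Um[measurable]: "U \<in> borel_measurable borel" using U by (rule borel_measurable_continuous_onI)
  let ?F = "\<lambda>n c. facet_points K n c"
  have plane: "norm n = 1" if "(n, c') \<in> facet_planes K" for n c'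
    using that by (fastforce simp: facet_planes_def outward_unit_normal_def)
  have Fm: "?F n c' \<in> sets borel" if "(n, c') \<in> facet_planes K" for n c'
    using plane[OF that] by (rule borel_facet_points)
  have id: "(\<integral>\<^sup>+x. ennreal (f (U x)) * indicator K x \<partial>lborel)
      = ennreal q * (\<Sum>(n, c)\<in>facet_planes K. \<integral>\<^sup>+x. ennreal (f (U x)) * indicator (?F n c) x \<partial>hyperplane_measure n c)"
    if f: "f \<in> borel_measurable borel" "\<And>s y. s > 0 \<Longrightarrow> f (s * y) = s * f y" for f :: "real \<Rightarrow> real"
  proof -
    have "ennreal (f (U (t *\<^sub>R x))) = ennreal (t ^ k) * ennreal (f (U x))" if "t > 0" for t x
      using that hom[OF that, of x] f(2)[of "t ^ k" "U x"] by (simp add: ennreal_mult')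
    then show ?thesis
      unfolding q_def using f(1) by (intro nn_integral_star_regular_homogeneous[OF solid star c]) auto
  qed
  note id_abs = id[of "\<lambda>y. \<bar>y\<bar>", simplified abs_mult abs_of_pos, simplified]
  note id_pos = id[of "\<lambda>y. y", simplified]
  note id_neg = id[of "\<lambda>y. - y", simplified]
  show intK: "set_integrable lborel K U"
    unfolding set_integrable_def using solid_polytope_compact[OF solid] U
    by (intro borel_integrable_compact) (auto intro: continuous_on_subset)
  have "(\<integral>\<^sup>+x. ennreal \<bar>U x\<bar> * indicator K x \<partial>lborel) < \<infinity>"
  proof -
    have "ennreal (norm (indicator K x *\<^sub>R U x)) = ennreal \<bar>U x\<bar> * indicator K x" for x
      by (auto simp: indicator_def)
    then show ?thesis
      using intK unfolding set_integrable_def integrable_iff_bounded by simp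
  qed
  then have fin: "(\<Sum>(n, c)\<in>facet_planes K. \<integral>\<^sup>+x. ennreal \<bar>U x\<bar> * indicator (?F n c) x \<partial>hyperplane_measure n c) < \<infinity>"
    using q by (subst (asm) id_abs) (auto simp: ennreal_mult_less_top)
  have fin1: "(\<integral>\<^sup>+x. ennreal \<bar>U x\<bar> * indicator (?F n c) x \<partial>hyperplane_measure n c) < \<infinity>"
    if "(n, c) \<in> facet_planes K" for n c
    using fin that dec(2) by (auto simp: ennreal_sum_less_top case_prod_unfold)
  show intF: "set_integrable (hyperplane_measure n c) (?F n c) U" if "(n, c) \<in> facet_planes K" for n c
    using fin1[OF that] Fm[OF that] by (intro set_integrableI_nn_integral_finite) auto
  have le: "(\<integral>\<^sup>+x. ennreal (f (U x)) * indicator (?F n c) x \<partial>hyperplane_measure n c) < \<infinity>"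
    if "(n, c) \<in> facet_planes K" "\<And>y. f y \<le> \<bar>y\<bar>" for n c and f :: "real \<Rightarrow> real"
    by (rule le_less_trans[OF nn_integral_mono fin1[OF that(1)]])
      (auto intro!: mult_right_mono ennreal_leI that(2))
  let ?S = "\<lambda>f. \<Sum>(n, c)\<in>facet_planes K. enn2real (\<integral>\<^sup>+x. ennreal (f (U x)) * indicator (?F n c) x \<partial>hyperplane_measure n c)"
  have "(LINT x:K|lborel. U x) = q * ?S (\<lambda>y. y) - q * ?S (\<lambda>y. - y)"
    unfolding set_lebesgue_integral_eq_nn_integral[OF intK] id_pos id_neg
    using q le[of _ _ "\<lambda>y. y"] le[of _ _ uminus]
    by (simp add: enn2real_mult enn2real_sum case_prod_unfold)
  also have "\<dots> = q * (\<Sum>(n, c)\<in>facet_planes K.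
      enn2real (\<integral>\<^sup>+x. ennreal (U x) * indicator (?F n c) x \<partial>hyperplane_measure n c)
      - enn2real (\<integral>\<^sup>+x. ennreal (- U x) * indicator (?F n c) x \<partial>hyperplane_measure n c))"
    by (simp add: right_diff_distrib sum_subtractf case_prod_unfold)
  also have "\<dots> = q * boundary_integral K U"
    unfolding boundary_integral_def
    by (intro arg_cong[of _ _ "(*) q"] sum.cong refl)
      (auto simp: set_lebesgue_integral_eq_nn_integral[OF intF])
  finally show "(LINT x:K|lborel. U x) = c / real (CARD('n) + k) * boundary_integral K U"
    by (simp add: q_def)
qed

lemma boundary_integral_add:
  assumes "\<And>n c. (n, c) \<in> facet_planes K \<Longrightarrow> set_integrable (hyperplane_measure n c) (facet_points K n c) U"
    and "\<And>n c. (n, c) \<in> facet_planes K \<Longrightarrow> set_integrable (hyperplane_measure n c) (facet_points K n c) V"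
  shows "boundary_integral K (\<lambda>x. U x + V x) = boundary_integral K U + boundary_integral K V"
  unfolding boundary_integral_def sum.distrib[symmetric]
  by (intro sum.cong refl) (auto simp: set_integral_add assms)

section \<open>Averages of quadratic polynomials\<close>

lemma finite_multi_indices: "finite {\<alpha> :: 'n :: finite \<Rightarrow> nat. (\<Sum>i\<in>UNIV. \<alpha> i) \<le> k}"
proof (rule finite_subset)
  have "\<alpha> i \<le> k" if "(\<Sum>i\<in>UNIV. \<alpha> i) \<le> k" for \<alpha> :: "'n \<Rightarrow> nat" and i
    using member_le_sum[of i UNIV \<alpha>] that by simp
  then show "{\<alpha> :: 'n \<Rightarrow> nat. (\<Sum>i\<in>UNIV. \<alpha> i) \<le> k}
      \<subseteq> {\<alpha>. \<forall>i. (i \<in> UNIV \<longrightarrow> \<alpha> i \<in> {..k}) \<and> (i \<notin> UNIV \<longrightarrow> \<alpha> i = 0)}"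
    by auto
  show "finite {\<alpha>. \<forall>i. (i \<in> (UNIV :: 'n set) \<longrightarrow> \<alpha> i \<in> {..k}) \<and> (i \<notin> UNIV \<longrightarrow> \<alpha> i = 0)}"
    by (intro finite_set_of_finite_funs) auto
qed

text \<open>Sort the monomials by total degree. A monomial of degree 1 is a coordinate, so the part of degree 1
  is linear.\<close>
lemma poly_space_2_homogeneous_parts:
  fixes U :: "real ^ 'n \<Rightarrow> real"
  assumes "U \<in> poly_space 2"
  obtains L Q where "linear L" "continuous_on UNIV Q" "\<And>t x. Q (t *\<^sub>R x) = t ^ 2 * Q x"
    "U = (\<lambda>x. U 0 + L x + Q x)"
proof -
  obtain a where U: "U = (\<lambda>x. \<Sum>\<alpha> | (\<Sum>i\<in>UNIV. \<alpha> i) \<le> 2. a \<alpha> * (\<Prod>i\<in>UNIV. (x $ i) ^ \<alpha> i))"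
    using assms unfolding poly_space_def by blast
  define S :: "nat \<Rightarrow> ('n \<Rightarrow> nat) set" where "S k = {\<alpha>. (\<Sum>i\<in>UNIV. \<alpha> i) = k}" for k
  define P where "P k x = (\<Sum>\<alpha>\<in>S k. a \<alpha> * (\<Prod>i\<in>UNIV. (x $ i) ^ \<alpha> i))" for k and x :: "real ^ 'n"
  have fin: "finite (S k)" for k
    by (rule finite_subset[OF _ finite_multi_indices[of k]]) (auto simp: S_def)
  have hom: "P k (t *\<^sub>R x) = t ^ k * P k x" for k t x
    unfolding P_def sum_distrib_left
  proof (intro sum.cong refl)
    fix \<alpha> assume "\<alpha> \<in> S k"
    then have "t ^ k = (\<Prod>i\<in>UNIV. t ^ \<alpha> i)" by (auto simp: S_def power_sum)
    then show "a \<alpha> * (\<Prod>i\<in>UNIV. ((t *\<^sub>R x) $ i) ^ \<alpha> i) = t ^ k * (a \<alpha> * (\<Prod>i\<in>UNIV. (x $ i) ^ \<alpha> i))"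
      by (simp only: vector_scaleR_component real_scaleR_def power_mult_distrib prod.distrib mult_ac)
  qed
  have cont: "continuous_on UNIV (P k)" for k
    unfolding P_def by (intro continuous_intros)
  have lin: "linear (P 1)"
  proof -
    have "\<exists>j. \<forall>x :: real^'n. (\<Prod>i\<in>UNIV. (x $ i) ^ \<alpha> i) = x $ j" if \<alpha>: "\<alpha> \<in> S 1" for \<alpha>
    proof -
      obtain j where j: "\<alpha> j = 1" "\<forall>i. j \<noteq> i \<longrightarrow> \<alpha> i = 0"
        using \<alpha> sum_eq_1_iff[of UNIV \<alpha>] by (auto simp: S_def)
      have "(\<Prod>i\<in>UNIV. (x $ i) ^ \<alpha> i) = (\<Prod>i\<in>UNIV. if i = j then x $ i else 1)" for x :: "real^'n"
        using j by (intro prod.cong) auto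
      then show ?thesis by auto
    qed
    then obtain j where j: "\<And>\<alpha> x. \<alpha> \<in> S 1 \<Longrightarrow> (\<Prod>i\<in>UNIV. (x $ i) ^ \<alpha> i) = (x :: real^'n) $ j \<alpha>"
      by metis
    have "P 1 x = (\<Sum>\<alpha>\<in>S 1. a \<alpha> * x $ j \<alpha>)" for x
      unfolding P_def by (intro sum.cong refl) (simp add: j)
    then show ?thesis
      by (intro linearI) (simp_all add: algebra_simps sum.distrib sum_distrib_left)
  qed
  have U_eq: "U x = P 0 x + P 1 x + P 2 x" for x
  proof -
    have "{\<alpha>. (\<Sum>i\<in>UNIV. \<alpha> i) \<le> 2} = (\<Union>k\<in>{..2}. S k)" by (auto simp: S_def)
    then have "U x = (\<Sum>\<alpha>\<in>(\<Union>k\<in>{..2}. S k). a \<alpha> * (\<Prod>i\<in>UNIV. (x $ i) ^ \<alpha> i))" by (simp add: U)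
    also have "\<dots> = (\<Sum>k\<le>2. P k x)"
      unfolding P_def using fin by (intro sum.UNION_disjoint) (auto simp: S_def)
    finally show ?thesis by (simp add: numeral_2_eq_2)
  qed
  have U0: "U 0 = P 0 x" for x
    using hom[of 0 0 x] hom[of 1 0 x] hom[of 2 0 x] by (simp add: U_eq)
  have "U x = U 0 + P 1 x + P 2 x" for x
    using U_eq[of x] U0[of x] by linarith
  then have "U = (\<lambda>x. U 0 + P 1 x + P 2 x)" by (rule ext)
  then show ?thesis by (rule that[OF lin cont hom])
qed

text \<open>The polynomial at which the supremum defining the optimal weight is attained.\<close>
lemma coordinate_square_in_poly_space_2: "(\<lambda>x :: real ^ 'n. (x $ j) ^ 2) \<in> poly_space 2"
proof -
  define \<beta> :: "'n \<Rightarrow> nat" where "\<beta> = (\<lambda>i. if i = j then 2 else 0)"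
  let ?S = "{\<alpha> :: 'n \<Rightarrow> nat. (\<Sum>i\<in>UNIV. \<alpha> i) \<le> 2}"
  let ?m = "\<lambda>x \<alpha>. \<Prod>i\<in>UNIV. ((x :: real ^ 'n) $ i) ^ \<alpha> i"
  have fin: "finite ?S" by (rule finite_multi_indices)
  have "\<beta> \<in> ?S" by (simp add: \<beta>_def)
  have "?m x \<beta> = (x $ j) ^ 2" for x
  proof -
    have "?m x \<beta> = (\<Prod>i\<in>UNIV. if i = j then (x $ i) ^ 2 else 1)"
      by (intro prod.cong) (auto simp: \<beta>_def)
    then show ?thesis by simp
  qed
  moreover have "(\<Sum>\<alpha>\<in>?S. (if \<alpha> = \<beta> then 1 else 0) * ?m x \<alpha>) = ?m x \<beta>" for x
  proof -
    have "(\<Sum>\<alpha>\<in>?S. (if \<alpha> = \<beta> then 1 else 0) * ?m x \<alpha>) = (\<Sum>\<alpha>\<in>?S. if \<alpha> = \<beta> then ?m x \<alpha> else 0)"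
      by (intro sum.cong) auto
    then show ?thesis using fin \<open>\<beta> \<in> ?S\<close> by simp
  qed
  ultimately show ?thesis
    unfolding poly_space_def by (auto intro!: exI[of _ "\<lambda>\<alpha>. if \<alpha> = \<beta> then 1 else 0"])
qed

text \<open>Isometries of \<open>K\<close> are linear and measure preserving, so they fix the first moment
  \<open>g\<close> of \<open>K\<close>, which must be the origin.\<close>
lemma linear_integral_symmetric_eq_0:
  fixes K :: "(real ^ 'n) set" and L :: "real ^ 'n \<Rightarrow> real"
  assumes K: "compact K"
    and orb: "{x. is_singleton (isometry_orbit K x)} = {0}"
    and L: "linear L"
  shows "(LINT x:K|lborel. L x) = 0"
proof -
  define g where "g = (LINT x:K|lborel. x)"
  have int: "integrable lborel (\<lambda>x. indicator K x *\<^sub>R x)"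
    using K by (intro borel_integrable_compact continuous_on_id)
  have commute: "(LINT x:K|lborel. T x) = T g" if "linear T" for T :: "real ^ 'n \<Rightarrow> 'b :: euclidean_space"
  proof -
    have T: "bounded_linear T" using that by (simp add: linear_conv_bounded_linear)
    have "(LINT x:K|lborel. T x) = (\<integral>x. T (indicator K x *\<^sub>R x) \<partial>lborel)"
      using that by (simp add: set_lebesgue_integral_def linear_cmul)
    also have "\<dots> = T (\<integral>x. indicator K x *\<^sub>R x \<partial>lborel)"
      by (rule integral_bounded_linear[OF T int])
    finally show ?thesis by (simp add: g_def set_lebesgue_integral_def)
  qed
  have "f g = g" if f: "f \<in> isometries_of K" for f
  proof -
    have ot: "orthogonal_transformation f" by (rule isometries_of_orthogonal[OF orb f])
    note [measurable] = borel_measurable_orthogonal_transformation[OF ot]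
    have [measurable]: "K \<in> sets borel" using K by (simp add: compact_imp_closed)
    have "f x \<in> K \<longleftrightarrow> x \<in> K" for x
      using f inj_image_mem_iff[OF orthogonal_transformation_inj[OF ot], of x K] by (simp add: isometries_of_def)
    then have ind: "indicator K (f x) = (indicator K x :: real)" for x by (simp add: indicator_def)
    have "g = (\<integral>x. indicator K x *\<^sub>R x \<partial>distr lborel borel f)"
      by (simp add: distr_lborel_orthogonal_transformation[OF ot] g_def set_lebesgue_integral_def)
    also have "\<dots> = (\<integral>x. indicator K (f x) *\<^sub>R f x \<partial>lborel)"
      by (intro integral_distr) auto
    also have "\<dots> = (LINT x:K|lborel. f x)"
      unfolding ind by (simp add: set_lebesgue_integral_def)
    also have "\<dots> = f g" by (intro commute orthogonal_transformation_linear ot)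
    finally show ?thesis by simp
  qed
  then have "g = 0" by (rule common_fixed_point_eq_0[OF orb])
  then show ?thesis using commute[OF L] L by (simp add: linear_0)
qed

text \<open>The parts of degree 0, 1 and 2 are multiplied by \<open>1\<close>, \<open>(D + 1)/D\<close> and \<open>(D + 2)/D\<close> in passing from cell
  averages to boundary averages. The linear part contributes 0 to both, and the constant part is
  \<open>U 0\<close>.\<close>
lemma boundary_average_poly_2:
  fixes K :: "(real ^ 'n) set"
  assumes K: "star_regular_centered K"
    and orb: "{x. is_singleton (isometry_orbit K x)} = {0}"
    and U: "U \<in> poly_space 2"
  shows "boundary_average K U = (real CARD('n) + 2) / real CARD('n) * cell_average K U - 2 / real CARD('n) * U 0"
proof -
  obtain c where solid: "solid_polytope K" and c: "\<forall>x n. outward_unit_normal K x n \<longrightarrow> n \<bullet> x = c"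
    and starlike: "starlike K"
    using K unfolding star_regular_centered_def by blast
  have compact: "compact K" by (rule solid_polytope_compact[OF solid])
  have star: "0 \<in> star_centers K"
    using star_center_at_origin[OF compact_imp_closed[OF compact] starlike orb] .
  note hom = star_regular_homogeneous_integral[OF solid star c]
  have c_pos: "c > 0" by (rule star_regular_cone_decomposition(1)[OF solid star c])
  have vol: "measure lborel K > 0" by (rule measure_solid_polytope_pos[OF solid])
  let ?D = "real CARD('n)"
  have D: "?D > 0" by simp
  obtain L Q where L: "linear L" and Q: "continuous_on UNIV Q" "\<And>t x. Q (t *\<^sub>R x) = t ^ 2 * Q x"
    and U_eq: "U = (\<lambda>x. U 0 + L x + Q x)"
    using poly_space_2_homogeneous_parts[OF U] by blast
  have Lc: "continuous_on UNIV L" using L by (simp add: linear_continuous_on linear_conv_bounded_linear)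
  define u where "u = U 0"
  note hom0 = hom[of "\<lambda>_. u" 0, simplified]
  note hom1 = hom[of L 1, OF Lc, simplified linear_cmul[OF L], simplified]
  note hom2 = hom[of Q 2, OF Q]
  have one: "boundary_integral K (\<lambda>_. 1) = ?D / c * measure lborel K"
  proof -
    have "K \<in> sets lborel" "emeasure lborel K < \<infinity>"
      using compact emeasure_compact_finite[OF compact] by (simp_all add: compact_imp_closed)
    then have "(LINT x:K|lborel. (1::real)) = measure lborel K"
      by (simp add: set_lebesgue_integral_def)
    then show ?thesis using hom(3)[of "\<lambda>_. 1" 0] c_pos D by (simp add: field_simps)
  qed
  have L0: "(LINT x:K|lborel. L x) = 0" by (rule linear_integral_symmetric_eq_0[OF compact orb L])
  have "boundary_integral K U = boundary_integral K (\<lambda>_. u) + boundary_integral K L + boundary_integral K Q"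
    unfolding U_eq[folded u_def] using hom0(2) hom1(2) hom2(2)
    by (simp add: boundary_integral_add set_integral_add)
  also have "\<dots> = ?D / c * (LINT x:K|lborel. u) + (?D + 2) / c * (LINT x:K|lborel. Q x)"
  proof -
    have "boundary_integral K L = 0" using hom1(3) L0 c_pos by (simp add: add_nonneg_eq_0_iff)
    moreover have "boundary_integral K (\<lambda>_. u) = ?D / c * (LINT x:K|lborel. u)"
      using hom0(3) c_pos D by (simp add: field_simps)
    moreover have "boundary_integral K Q = (?D + 2) / c * (LINT x:K|lborel. Q x)"
      using hom2(3) c_pos D by (simp add: field_simps)
    ultimately show ?thesis by simp
  qed
  finally have B: "boundary_integral K U = ?D / c * (LINT x:K|lborel. u) + (?D + 2) / c * (LINT x:K|lborel. Q x)" .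
  have C: "(LINT x:K|lborel. U x) = (LINT x:K|lborel. u) + (LINT x:K|lborel. Q x)"
    unfolding U_eq[folded u_def] using hom0(1) hom1(1) hom2(1) L0
    by (simp add: set_integral_add)
  have u: "(LINT x:K|lborel. u) = u * measure lborel K"
    using compact by (simp add: set_lebesgue_integral_def)
  show ?thesis
    unfolding boundary_average_def cell_average_def B C u one using c_pos D vol
    by (simp add: u_def[symmetric] field_simps)
qed

section \<open>The optimal interior weight\<close>

theorem theorem6p6:
  fixes K :: "(real ^ 'n) set" and V :: "(real ^ 'n \<Rightarrow> real) set"
  assumes "star_regular_centered K"
    and "{x. is_singleton (isometry_orbit K x)} = {0}"
    and "V = poly_space 2"
  shows "weight_ratios K V \<noteq> {} \<and> bdd_above (weight_ratios K V) \<and>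
    optimal_weight K V = (real CARD('n) + 2) / real CARD('n) \<and>
    (\<forall>U\<in>V. U 0 \<ge> 0 \<longleftrightarrow> retentional K V U \<ge> 0) \<and>
    (\<forall>Q b U h \<mu> dt.
       boundary_quadrature K V Q b \<longrightarrow>
       U \<in> V \<longrightarrow> (\<forall>x\<in>Q. U x \<ge> 0) \<longrightarrow> U 0 \<ge> 0 \<longrightarrow>
       (\<forall>x\<in>Q. h x \<le> \<mu> * U x) \<longrightarrow>
       dt \<ge> 0 \<longrightarrow> \<mu> * dt \<le> 1 / optimal_weight K V \<longrightarrow>
       cell_average K U - dt * quadrature Q b h \<ge> 0)"
proof -
  define M where "M = (real CARD('n) + 2) / real CARD('n)"
  have M: "M > 0" by (simp add: M_def add_pos_pos)
  have solid: "solid_polytope K" and "starlike K"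
    using assms(1) unfolding star_regular_centered_def by blast+
  have compact: "compact K" by (rule solid_polytope_compact[OF solid])
  have "0 \<in> star_centers K"
    using star_center_at_origin[OF compact_imp_closed[OF compact] \<open>starlike K\<close> assms(2)] .
  then have zero: "0 \<in> K" by (simp add: star_centers_def)
  have B: "boundary_average K U = M * cell_average K U - 2 / real CARD('n) * U 0" if "U \<in> V" for U
    unfolding M_def by (rule boundary_average_poly_2[OF assms(1,2)]) (use that assms(3) in simp)
  have upper: "r \<le> M" if "r \<in> weight_ratios K V" for r
  proof -
    obtain U where U: "r = boundary_average K U / cell_average K U" "U \<in> V"
        "\<forall>x\<in>K. U x \<ge> 0" "cell_average K U > 0"
      using \<open>r \<in> weight_ratios K V\<close> unfolding weight_ratios_def by blast
    then have "2 / real CARD('n) * U 0 \<ge> 0" using zero by simp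
    then show ?thesis using U(4) by (simp add: U(1) B[OF U(2)] divide_le_eq)
  qed
  have attained: "M \<in> weight_ratios K V"
  proof -
    fix j :: 'n
    let ?U = "\<lambda>x :: real ^ 'n. (x $ j) ^ 2"
    have UV: "?U \<in> V" unfolding assms(3) by (rule coordinate_square_in_poly_space_2)
    have pos: "cell_average K ?U > 0"
    proof -
      have int: "set_integrable lborel K ?U"
        unfolding set_integrable_def using compact
        by (intro borel_integrable_compact) (auto intro!: continuous_intros)
      have nonneg: "(LINT x:K|lborel. ?U x) \<ge> 0"
        by (simp add: set_lebesgue_integral_def)
      moreover have "(LINT x:K|lborel. ?U x) \<noteq> 0"
      proof
        assume "(LINT x:K|lborel. ?U x) = 0"
        then have "AE x in lborel. indicator K x *\<^sub>R ?U x = 0"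
          using integral_nonneg_eq_0_iff_AE[of lborel "\<lambda>x. indicator K x *\<^sub>R ?U x"] int
          by (simp add: set_lebesgue_integral_def set_integrable_def)
        moreover have "AE x in lborel. (x :: real ^ 'n) $ j \<noteq> 0"
        proof -
          have "negligible {x :: real ^ 'n. axis j 1 \<bullet> x = 0}"
            by (rule negligible_hyperplane) (simp add: axis_eq_0_iff)
          then have "AE x in lebesgue. x \<notin> {x :: real ^ 'n. axis j 1 \<bullet> x = 0}"
            by (intro AE_not_in) (simp add: negligible_iff_null_sets)
          then show ?thesis by (simp add: AE_completion_iff inner_axis')
        qed
        ultimately have "AE x in lborel. x \<notin> K"
          by eventually_elim (auto simp: indicator_def split: if_splits)
        then have "K \<in> null_sets lborel"
          using compact by (subst AE_iff_null_sets) (auto simp: compact_imp_closed)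
        then show False
          using measure_solid_polytope_pos[OF solid] by (simp add: measure_eq_0_null_sets)
      qed
      ultimately show ?thesis
        using measure_solid_polytope_pos[OF solid] by (simp add: cell_average_def)
    qed
    then have "M = boundary_average K ?U / cell_average K ?U"
      by (simp add: B[OF UV])
    with UV pos show ?thesis unfolding weight_ratios_def by auto
  qed
  have opt: "optimal_weight K V = M"
    unfolding optimal_weight_def using attained upper by (rule cSup_eq_maximum)
  have ret: "U 0 \<ge> 0 \<longleftrightarrow> retentional K V U \<ge> 0" if "U \<in> V" for U
    by (simp add: retentional_def opt B[OF that] zero_le_divide_iff)
  have euler: "cell_average K U - dt * quadrature Q b h \<ge> 0"
    if quad: "boundary_quadrature K V Q b" and U: "U \<in> V" "\<forall>x\<in>Q. U x \<ge> 0" "U 0 \<ge> 0"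
      and h: "\<forall>x\<in>Q. h x \<le> \<mu> * U x" and dt: "dt \<ge> 0" "\<mu> * dt \<le> 1 / M" for Q b U h \<mu> dt
  proof -
    have b: "\<And>x. x \<in> Q \<Longrightarrow> b x > 0" and QB: "quadrature Q b U = boundary_average K U"
      using quad U(1) unfolding boundary_quadrature_def by auto
    have "quadrature Q b h \<le> \<mu> * quadrature Q b U"
      unfolding quadrature_def sum_distrib_left
      using h b by (intro sum_mono) (simp add: mult_left_mono mult.left_commute less_imp_le)
    from mult_left_mono[OF this dt(1)]
    have "dt * quadrature Q b h \<le> (\<mu> * dt) * quadrature Q b U" by (simp add: mult_ac)
    also have "\<dots> \<le> 1 / M * quadrature Q b U"
      using dt(2) U(2) b by (intro mult_right_mono) (auto simp: quadrature_def less_imp_le intro!: sum_nonneg)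
    also have "\<dots> \<le> cell_average K U"
    proof -
      have "2 / real CARD('n) * U 0 \<ge> 0" using U(3) by simp
      then show ?thesis using M by (simp add: QB B[OF U(1)] divide_le_eq mult.commute)
    qed
    finally show ?thesis by simp
  qed
  have "bdd_above (weight_ratios K V)" using upper by (rule bdd_aboveI)
  then show ?thesis
    unfolding opt M_def[symmetric] using attained ret euler by blast
qed

end
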